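(* Let $k$ be a fixed positive integer and $\varepsilon>0$. There is a linear programming relaxation of $k$-set packing whose size is polynomial in the number $n$ of sets of the instance and whose integrality gap is at most $\frac{k}{3}+1+\varepsilon$.
   Context: $k$-set packing: given a finite universe $\mathcal{U}$ and a collection $\mathcal{C}$ of $n$ subsets of $\mathcal{U}$, each of cardinality exactly $k$, find a collection of pairwise disjoint members of $\mathcal{C}$ (a packing) of maximum cardinality. A relaxation is an LP whose optimum value is at least the maximum packing size on every instance; its integrality gap is the supremum over instances of the ratio between its optimum value and the maximum packing size. *)

theory Defs
  imports
    Complex_Main
    "HOL-Library.Disjoint_Sets"
    "HOL-Library.Extended_Real"
    "HOL-Library.Log_Nat"
    "HOL-Computational_Algebra.Polynomial"
begin

section \<open>Set packing\<close>

definition set_packing_instance :: "nat \<Rightarrow> nat set \<Rightarrow> nat set set \<Rightarrow> bool" where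
  "set_packing_instance k U C \<longleftrightarrow> finite U \<and> C \<subseteq> Pow U \<and> (\<forall>S\<in>C. card S = k)"

definition packings :: "nat set set \<Rightarrow> nat set set set" where
  "packings C = {P. P \<subseteq> C \<and> disjoint P}"

definition max_packing :: "nat set set \<Rightarrow> nat" where
  "max_packing C = Max (card ` packings C)"

section \<open>Linear programs\<close>

text \<open>
  The program \<open>LP d r A b c\<close> has \<open>d\<close> real variables \<open>x\<^sub>j\<close> (\<open>j < d\<close>), which are free in sign,
  and reads: maximize \<open>\<Sum>j<d. c j * x j\<close> subject to \<open>(\<Sum>j<d. A i j * x j) \<le> b i\<close> for all \<open>i < r\<close>.
  The coefficient functions are irrelevant outside these index ranges.
\<close>

datatype 'c lp =
  LP (num_vars: nat) (num_constrs: nat)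
     (mat: "nat \<Rightarrow> nat \<Rightarrow> 'c") (rhs: "nat \<Rightarrow> 'c") (obj: "nat \<Rightarrow> 'c")

definition lp_feasible :: "int lp \<Rightarrow> (nat \<Rightarrow> real) \<Rightarrow> bool" where
  "lp_feasible L x \<longleftrightarrow>
     (\<forall>i<num_constrs L. (\<Sum>j<num_vars L. of_int (mat L i j) * x j) \<le> of_int (rhs L i))"

definition lp_value :: "int lp \<Rightarrow> (nat \<Rightarrow> real) \<Rightarrow> real" where
  "lp_value L x = (\<Sum>j<num_vars L. of_int (obj L j) * x j)"

text \<open>The optimum is \<open>- \<infinity>\<close> for an infeasible and \<open>\<infinity>\<close> for an unbounded program.\<close>

definition lp_opt :: "int lp \<Rightarrow> ereal" where
  "lp_opt L = (SUP x\<in>{x. lp_feasible L x}. ereal (lp_value L x))"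

text \<open>
  The size is the encoding length: every coefficient contributes its number of binary digits and
  one more bit for the sign. In particular it bounds the number of variables and of constraints.
\<close>

definition coeff_size :: "int \<Rightarrow> nat" where
  "coeff_size a = 1 + nat (bitlen \<bar>a\<bar>)"

definition lp_size :: "int lp \<Rightarrow> nat" where
  "lp_size L =
     (\<Sum>i<num_constrs L. \<Sum>j<num_vars L. coeff_size (mat L i j)) +
     (\<Sum>i<num_constrs L. coeff_size (rhs L i)) +
     (\<Sum>j<num_vars L. coeff_size (obj L j))"

section \<open>Linear programming relaxations\<close>

text \<open>
  If the program could be chosen separately for every instance, the notion would be void: the
  one-variable program ``maximize \<open>z\<close> subject to \<open>z \<le> max_packing C\<close>'' would be a relaxation
  without any gap. A relaxation is therefore a family with a single program for each number \<open>n\<close>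
  of sets, into which the instance is entered as data, each coefficient being an affine function,
  with integer coefficients, of the 0/1 indicator vector of the instance. (For example, the
  degree constraints of the standard relaxation have the coefficients \<open>[S \<in> C]\<close>.)

  The indicator vector is indexed by sets of natural numbers. Up to renaming, the at most
  \<open>k * n\<close> elements that occur in an instance with \<open>n\<close> sets of size \<open>k\<close> are the numbers below
  \<open>k * n\<close>; \<open>normalize_sets\<close> renames them in increasing order and so ignores unused elements of the
  universe.
\<close>

datatype affine_form = Affine (const_part: int) (lin_part: "nat set \<Rightarrow> int")

definition affine_eval :: "nat set set \<Rightarrow> affine_form \<Rightarrow> int" where
  "affine_eval C \<alpha> = const_part \<alpha> + (\<Sum>S\<in>C. lin_part \<alpha> S)"

definition normalize_sets :: "nat set set \<Rightarrow> nat set set" where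
  "normalize_sets C = (\<lambda>S. (\<lambda>v. card {u \<in> \<Union>C. u < v}) ` S) ` C"

type_synonym lp_family = "nat \<Rightarrow> affine_form lp"

definition lp_of_instance :: "lp_family \<Rightarrow> nat set set \<Rightarrow> int lp" where
  "lp_of_instance R C = map_lp (affine_eval (normalize_sets C)) (R (card C))"

definition lp_relaxation :: "nat \<Rightarrow> lp_family \<Rightarrow> bool" where
  "lp_relaxation k R \<longleftrightarrow>
     (\<forall>U C. set_packing_instance k U C \<longrightarrow>
        ereal (real (max_packing C)) \<le> lp_opt (lp_of_instance R C))"

definition polynomial_size :: "nat \<Rightarrow> lp_family \<Rightarrow> bool" where
  "polynomial_size k R \<longleftrightarrow>
     (\<exists>p :: nat poly. \<forall>U C. set_packing_instance k U C \<longrightarrow>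
        lp_size (lp_of_instance R C) \<le> poly p (card C))"

text \<open>Instances without sets have no packing but the empty one, so their ratio is undefined.\<close>

definition integrality_gap :: "nat \<Rightarrow> lp_family \<Rightarrow> ereal" where
  "integrality_gap k R =
     (SUP (U, C) \<in> {(U, C). set_packing_instance k U C \<and> C \<noteq> {}}.
        lp_opt (lp_of_instance R C) / ereal (real (max_packing C)))"

end

theory Submission
  imports Defs
begin

text \<open>
  The instance may enter the coefficients of the program, and linear inequalities can simulate
  NOR gates on 0/1 values; hence the program can evaluate a polynomial-size circuit that runs a
  local search for a packing \<open>A\<close> and then maximize \<open>z\<close> subject to \<open>3 z \<le> (k + 3) |A|\<close>. It remains to
  find a local search, with a nonuniform circuit, whose result satisfies \<open>3 |B| \<le> (k + 3) |A|\<close> for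
  every packing \<open>B\<close>.

  Regard each \<open>b \<in> B\<close> as an edge on the set \<open>nbrs A b\<close> of members of \<open>A\<close> that it meets. These sets have
  total size at most \<open>k |A|\<close>, so the bound holds if every \<open>b\<close> meets \<open>A\<close>, at most \<open>|A|\<close> sets \<open>b\<close> have one
  neighbour and at most \<open>2 |A|\<close> have one or two. If the last fails, some subgraph has minimum degree 3;
  its breadth-first balls double in size as long as they contain at most one non-tree edge, so two
  non-tree edges occur at logarithmic depth. Together with the tree paths from their ends these
  form a set of logarithmic size having more edges than vertices, an improvement.

  Such a set \<open>X\<close> is found by placing tokens on the ends of two edges and moving tokens along further
  edges until all have merged: \<open>X\<close> has two more members than there have been moves, and every neighbour of
  \<open>X\<close> carries a token or was left by one. Disjointness of the sets used is ensured by colour coding,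
  where a perfect hash family of polynomial size is hard-wired into the circuit.
\<close>

section \<open>Circuits and linear programs\<close>

type_synonym instance_pred = "nat set set \<Rightarrow> bool"

text \<open>Each gate is kept as the Boolean function of the instance that it computes, which merges
  syntax and semantics. A \<open>Nor\<close> gate has unbounded fan-in and reads earlier positions
  only; with an empty \<open>J\<close> it is the constant true.\<close>

inductive circuit :: "instance_pred list \<Rightarrow> bool" where
  Nil: "circuit []"
| Input: "circuit xs \<Longrightarrow> circuit (xs @ [\<lambda>C. S \<in> C])"
| Nor: "circuit xs \<Longrightarrow> J \<subseteq> {..<length xs} \<Longrightarrow> circuit (xs @ [\<lambda>C. \<forall>j\<in>J. \<not> (xs ! j) C])"

text \<open>Quantifying over all circuits that already contain \<open>F\<close>, and only appending
  to them, makes the bounds compose: earlier values stay available and \<open>c\<close> counts the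
  new gates alone.\<close>

definition computes :: "nat \<Rightarrow> instance_pred set \<Rightarrow> instance_pred set \<Rightarrow> bool" where
  "computes c F G \<longleftrightarrow> (\<forall>xs. circuit xs \<and> F \<subseteq> set xs \<longrightarrow>
     (\<exists>ys. circuit (xs @ ys) \<and> length ys \<le> c \<and> G \<subseteq> set (xs @ ys)))"

section \<open>Calculus of circuit sizes\<close>

lemma computes_subset: "G \<subseteq> F \<Longrightarrow> computes c F G"
  unfolding computes_def by (auto intro!: exI[of _ "[]"])

lemma computes_mono: "computes c F G \<Longrightarrow> F \<subseteq> F' \<Longrightarrow> G' \<subseteq> G \<Longrightarrow> c \<le> c' \<Longrightarrow> computes c' F' G'"
  unfolding computes_def by (meson order_trans)

lemma computes_trans:
  assumes "computes c F G" and "computes c' (F \<union> G) H"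
  shows "computes (c + c') F (F \<union> G \<union> H)"
  unfolding computes_def
proof (intro allI impI)
  fix xs assume xs: "circuit xs \<and> F \<subseteq> set xs"
  then obtain ys where ys: "circuit (xs @ ys)" "length ys \<le> c" "G \<subseteq> set (xs @ ys)"
    using assms(1) unfolding computes_def by blast
  then have "F \<union> G \<subseteq> set (xs @ ys)" using xs by auto
  then obtain zs where zs: "circuit ((xs @ ys) @ zs)" "length zs \<le> c'" "H \<subseteq> set ((xs @ ys) @ zs)"
    using assms(2) ys(1) unfolding computes_def by blast
  then show "\<exists>ys. circuit (xs @ ys) \<and> length ys \<le> c + c' \<and> F \<union> G \<union> H \<subseteq> set (xs @ ys)"
    using xs ys by (intro exI[of _ "ys @ zs"]) auto
qed

lemma computes_trans': "computes c F G \<Longrightarrow> computes c' (F \<union> G) H \<Longrightarrow> computes (c + c') F H"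
  by (rule computes_mono[OF computes_trans]) auto

lemma computes_Un: "computes c F G \<Longrightarrow> computes c' F H \<Longrightarrow> computes (c + c') F (G \<union> H)"
  by (rule computes_mono[OF computes_trans[of c F G c' H]]) (auto intro: computes_mono)

lemma computes_UN:
  assumes "finite I" and "\<And>i. i \<in> I \<Longrightarrow> computes c F (G i)"
  shows "computes (card I * c) F (\<Union>i\<in>I. G i)"
  using assms
proof (induction I rule: finite_induct)
  case (insert i I)
  then have "computes (c + card I * c) F (G i \<union> (\<Union>i\<in>I. G i))" by (intro computes_Un) auto
  then show ?case using insert by simp
qed (simp add: computes_subset)

lemma computes_image:
  assumes "finite I" and "\<And>i. i \<in> I \<Longrightarrow> computes c F {g i}"
  shows "computes (card I * c) F (g ` I)"
  using computes_UN[OF assms, of "\<lambda>i. i"] by (simp add: UNION_singleton_eq_range)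

lemma computes_input: "computes 1 F {\<lambda>C. S \<in> C}"
  unfolding computes_def
proof (intro allI impI)
  fix xs assume "circuit xs \<and> F \<subseteq> set xs"
  then have "circuit (xs @ [\<lambda>C. S \<in> C])" by (intro circuit.Input) auto
  then show "\<exists>ys. circuit (xs @ ys) \<and> length ys \<le> 1 \<and> {\<lambda>C. S \<in> C} \<subseteq> set (xs @ ys)"
    by (intro exI[of _ "[\<lambda>C. S \<in> C]"]) auto
qed

lemma computes_nor:
  assumes "F' \<subseteq> F" shows "computes 1 F {\<lambda>C. \<forall>f\<in>F'. \<not> f C}"
  unfolding computes_def
proof (intro allI impI)
  fix xs assume xs: "circuit xs \<and> F \<subseteq> set xs"
  define J where "J = {j. j < length xs \<and> xs ! j \<in> F'}"
  have "(\<lambda>C. \<forall>f\<in>F'. \<not> f C) = (\<lambda>C. \<forall>j\<in>J. \<not> (xs ! j) C)"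
  proof
    fix C
    have "F' = (\<lambda>j. xs ! j) ` J"
      using xs assms unfolding J_def by (fastforce simp: in_set_conv_nth)
    then show "(\<forall>f\<in>F'. \<not> f C) = (\<forall>j\<in>J. \<not> (xs ! j) C)" by auto
  qed
  moreover have "circuit (xs @ [\<lambda>C. \<forall>j\<in>J. \<not> (xs ! j) C])"
    using xs by (intro circuit.Nor) (auto simp: J_def)
  ultimately show "\<exists>ys. circuit (xs @ ys) \<and> length ys \<le> 1 \<and> {\<lambda>C. \<forall>f\<in>F'. \<not> f C} \<subseteq> set (xs @ ys)"
    by (intro exI[of _ "[\<lambda>C. \<forall>f\<in>F'. \<not> f C]"]) auto
qed

text \<open>A NOR gate followed by a one-input NOR, which negates it. With an empty
  \<open>F'\<close> this yields the constant false.\<close>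

lemma computes_or:
  assumes "F' \<subseteq> F" shows "computes 2 F {\<lambda>C. \<exists>f\<in>F'. f C}"
proof -
  define n :: instance_pred where "n = (\<lambda>C. \<forall>f\<in>F'. \<not> f C)"
  define o' :: instance_pred where "o' = (\<lambda>C. \<forall>f\<in>{n}. \<not> f C)"
  have "computes 1 F {n}" unfolding n_def by (rule computes_nor[OF assms])
  moreover have "computes 1 (F \<union> {n}) {o'}" unfolding o'_def by (rule computes_nor) simp
  ultimately have c: "computes (1 + 1) F {o'}" by (rule computes_trans')
  have "o' = (\<lambda>C. \<exists>f\<in>F'. f C)" by (simp add: o'_def n_def)
  from c[unfolded this one_add_one] show ?thesis .
qed

text \<open>The negations of the members of \<open>F\<close> are computed once and shared. A term is
  then a single NOR of the negations of \<open>P i\<close> together with \<open>Q i\<close>, so the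
  cost is a sum and not a product.\<close>

lemma computes_dnf:
  assumes "finite F" and "finite I" and PQ: "\<And>i. i \<in> I \<Longrightarrow> P i \<subseteq> F \<and> Q i \<subseteq> F"
  shows "computes (card F + card I + 2) F {\<lambda>C. \<exists>i\<in>I. (\<forall>f\<in>P i. f C) \<and> (\<forall>f\<in>Q i. \<not> f C)}"
proof -
  define neg :: "instance_pred \<Rightarrow> instance_pred" where "neg f = (\<lambda>C. \<forall>g\<in>{f}. \<not> g C)" for f
  define trm where "trm i = (\<lambda>C. \<forall>f\<in>neg ` P i \<union> Q i. \<not> f C)" for i
  have "computes (card F * 1) F (neg ` F)"
  proof (rule computes_image[OF assms(1)])
    fix f assume "f \<in> F"
    then show "computes 1 F {neg f}" unfolding neg_def by (intro computes_nor) auto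
  qed
  moreover have "computes (card I * 1) (F \<union> neg ` F) (trm ` I)"
  proof (rule computes_image[OF assms(2)])
    fix i assume "i \<in> I"
    then have "neg ` P i \<union> Q i \<subseteq> F \<union> neg ` F" using PQ by blast
    then show "computes 1 (F \<union> neg ` F) {trm i}" unfolding trm_def by (rule computes_nor)
  qed
  ultimately have "computes (card F * 1 + card I * 1) F (trm ` I)"
    by (rule computes_trans')
  moreover have "computes 2 (F \<union> trm ` I) {\<lambda>C. \<exists>f\<in>trm ` I. f C}"
    by (rule computes_or) auto
  ultimately have c: "computes (card F * 1 + card I * 1 + 2) F {\<lambda>C. \<exists>f\<in>trm ` I. f C}"
    by (rule computes_trans')
  have "(\<lambda>C. \<exists>f\<in>trm ` I. f C) = (\<lambda>C. \<exists>i\<in>I. (\<forall>f\<in>P i. f C) \<and> (\<forall>f\<in>Q i. \<not> f C))"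
  proof
    fix C
    have "trm i C \<longleftrightarrow> (\<forall>f\<in>P i. f C) \<and> (\<forall>f\<in>Q i. \<not> f C)" for i
      by (simp add: trm_def neg_def ball_Un)
    then show "(\<exists>f\<in>trm ` I. f C) = (\<exists>i\<in>I. (\<forall>f\<in>P i. f C) \<and> (\<forall>f\<in>Q i. \<not> f C))"
      by simp
  qed
  then have eq: "{\<lambda>C. \<exists>f\<in>trm ` I. f C} = {\<lambda>C. \<exists>i\<in>I. (\<forall>f\<in>P i. f C) \<and> (\<forall>f\<in>Q i. \<not> f C)}"
    by (rule arg_cong[of _ _ "\<lambda>x. {x}"])
  show ?thesis using c unfolding eq mult_1_right .
qed

section \<open>Linear inequalities that force the gate values\<close>

definition row_sat :: "nat \<Rightarrow> nat set set \<Rightarrow> (nat \<Rightarrow> real) \<Rightarrow> (nat \<Rightarrow> int) \<times> affine_form \<Rightarrow> bool" where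
  "row_sat d C z = (\<lambda>(a, \<beta>). (\<Sum>j<d. of_int (a j) * z j) \<le> of_int (affine_eval C \<beta>))"

text \<open>Left-hand coefficients are fixed integers; the instance enters through the right-hand
  side only. Bounding both by one, uniformly in the instance, later controls the encoding
  length.\<close>

definition small_row :: "(nat \<Rightarrow> int) \<times> affine_form \<Rightarrow> bool" where
  "small_row = (\<lambda>(a, \<beta>). (\<forall>j. \<bar>a j\<bar> \<le> 1) \<and> (\<forall>C. finite C \<longrightarrow> \<bar>affine_eval C \<beta>\<bar> \<le> 1))"

definition const_affine :: "int \<Rightarrow> affine_form" where
  "const_affine c = Affine c (\<lambda>_. 0)"

definition indicator_affine :: "int \<Rightarrow> nat set \<Rightarrow> affine_form" where
  "indicator_affine s S = Affine 0 (\<lambda>S'. if S' = S then s else 0)"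

lemma affine_eval_const [simp]: "affine_eval C (const_affine c) = c"
  by (simp add: affine_eval_def const_affine_def)

lemma affine_eval_indicator [simp]:
  "finite C \<Longrightarrow> affine_eval C (indicator_affine s S) = (if S \<in> C then s else 0)"
  by (simp add: affine_eval_def indicator_affine_def sum.delta)

lemma sum_of_int_if:
  fixes z :: "nat \<Rightarrow> real"
  assumes "K \<subseteq> {..<d}"
  shows "(\<Sum>j<d. of_int (if j \<in> K then s else 0) * z j) = of_int s * sum z K"
proof -
  have "(\<Sum>j<d. of_int (if j \<in> K then s else 0) * z j) = (\<Sum>j\<in>{..<d}. if j \<in> K then of_int s * z j else 0)"
    by (rule sum.cong) auto
  also have "\<dots> = (\<Sum>j\<in>K. of_int s * z j)"
    using assms by (simp add: sum.If_cases Int_absorb1)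
  finally show ?thesis by (simp add: sum_distrib_left)
qed

definition if_row :: "nat set \<Rightarrow> int \<Rightarrow> affine_form \<Rightarrow> (nat \<Rightarrow> int) \<times> affine_form" where
  "if_row K s \<beta> = (\<lambda>j. if j \<in> K then s else 0, \<beta>)"

lemma row_sat_if:
  assumes "K \<subseteq> {..<d}"
  shows "row_sat d C z (if_row K s \<beta>) \<longleftrightarrow> of_int s * sum z K \<le> of_int (affine_eval C \<beta>)"
  using sum_of_int_if[OF assms] by (simp add: row_sat_def if_row_def)

lemma all_less_snoc:
  "(\<forall>i<length (xs @ [g]). (z i :: real) = of_bool (((xs @ [g]) ! i) C)) \<longleftrightarrow>
   (\<forall>i<length xs. z i = of_bool ((xs ! i) C)) \<and> z (length xs) = of_bool (g C)"
  by (auto simp: nth_append less_Suc_eq)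

text \<open>Once the earlier variables are forced to 0 or 1, a NOR gate \<open>z\<close> with inputs
  \<open>z j\<close> is determined by \<open>0 \<le> z \<le> 1\<close>, by
  \<open>z + z j \<le> 1\<close> for each \<open>j\<close>, and by \<open>z\<close> plus the sum of
  all \<open>z j\<close> being at least 1. An input gate is pinned to the indicator by two opposite
  inequalities. The dimension \<open>d\<close> may exceed the number of gates, which leaves room for
  an objective variable.\<close>

lemma circuit_rows:
  assumes "circuit xs" and "length xs \<le> d"
  shows "\<exists>R. finite R \<and> card R \<le> length xs * (d + 3) \<and> (\<forall>r\<in>R. small_row r) \<and>
    (\<forall>C z. finite C \<longrightarrow>
      ((\<forall>r\<in>R. row_sat d C z r) \<longleftrightarrow> (\<forall>i<length xs. z i = of_bool ((xs ! i) C))))"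
  using assms
proof (induction xs rule: circuit.induct)
  case Nil
  show ?case by (intro exI[of _ "{}"]) auto
next
  case (Input xs S)
  then obtain R where R: "finite R" "card R \<le> length xs * (d + 3)" "\<And>r. r \<in> R \<Longrightarrow> small_row r"
    and sat: "\<And>C z. finite C \<Longrightarrow>
      (\<forall>r\<in>R. row_sat d C z r) \<longleftrightarrow> (\<forall>i<length xs. z i = of_bool ((xs ! i) C))"
    by auto
  let ?i = "length xs"
  define R' where "R' = {if_row {?i} 1 (indicator_affine 1 S), if_row {?i} (-1) (indicator_affine (-1) S)}"
  have i: "{?i} \<subseteq> {..<d}" using Input.prems by auto
  show ?case
  proof (intro exI[of _ "R \<union> R'"] conjI allI impI)
    have "card (R \<union> R') \<le> card R + card R'" by (rule card_Un_le)
    also have "card R' \<le> 2" unfolding R'_def by (simp add: card_insert_if)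
    finally show "card (R \<union> R') \<le> length (xs @ [\<lambda>C. S \<in> C]) * (d + 3)" using R by simp
    show "\<forall>r\<in>R \<union> R'. small_row r" using R by (auto simp: R'_def if_row_def small_row_def)
    fix C z assume C: "finite (C :: nat set set)"
    have "(\<forall>r\<in>R'. row_sat d C z r) \<longleftrightarrow> z ?i = of_bool (S \<in> C)"
      using C unfolding R'_def by (auto simp: row_sat_if[OF i])
    then show "(\<forall>r\<in>R \<union> R'. row_sat d C z r) \<longleftrightarrow>
       (\<forall>i<length (xs @ [\<lambda>C. S \<in> C]). z i = of_bool (((xs @ [\<lambda>C. S \<in> C]) ! i) C))"
      unfolding all_less_snoc ball_Un using sat[OF C, of z] by blast
  qed (use R in \<open>auto simp: R'_def\<close>)
next
  case (Nor xs J)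
  then obtain R where R: "finite R" "card R \<le> length xs * (d + 3)" "\<And>r. r \<in> R \<Longrightarrow> small_row r"
    and sat: "\<And>C z. finite C \<Longrightarrow>
      (\<forall>r\<in>R. row_sat d C z r) \<longleftrightarrow> (\<forall>i<length xs. z i = of_bool ((xs ! i) C))"
    by auto
  let ?i = "length xs" and ?g = "\<lambda>C. \<forall>j\<in>J. \<not> (xs ! j) C"
  define row :: "nat set \<Rightarrow> int \<Rightarrow> int \<Rightarrow> (nat \<Rightarrow> int) \<times> affine_form" where
    "row K s t = if_row K s (const_affine t)" for K s t
  \<comment> \<open>The upper bound by one matters for an empty \<open>J\<close>, when there is no
    pair row to imply it.\<close>
  define R' where "R' = {row {?i} 1 1, row {?i} (-1) 0, row (insert ?i J) (-1) (-1)} \<union>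
    (\<lambda>j. row {?i, j} 1 1) ` J"
  have J: "finite J" "?i \<notin> J" using Nor finite_subset by auto
  have cJ: "card J \<le> length xs" using Nor.hyps card_mono[of "{..<length xs}" J] by auto
  have sub: "{?i} \<subseteq> {..<d}" "insert ?i J \<subseteq> {..<d}" "j \<in> J \<Longrightarrow> {?i, j} \<subseteq> {..<d}" for j
    using Nor by auto
  have rs: "row_sat d C z (row K s t) \<longleftrightarrow> of_int s * sum z K \<le> of_int t" if "K \<subseteq> {..<d}" for K s t C z
    unfolding row_def using row_sat_if[OF that] by simp
  show ?case
  proof (intro exI[of _ "R \<union> R'"] conjI allI impI)
    have "card R' \<le> 3 + card J"
      unfolding R'_def by (intro order_trans[OF card_Un_le] add_mono card_image_le J) (simp add: card_insert_if)
    then have "card (R \<union> R') \<le> card R + (3 + d)"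
      using card_Un_le[of R R'] cJ Nor.prems by auto
    then show "card (R \<union> R') \<le> length (xs @ [?g]) * (d + 3)" using R by simp
    show "\<forall>r\<in>R \<union> R'. small_row r" using R by (auto simp: R'_def row_def if_row_def small_row_def)
    show "finite (R \<union> R')" using R J by (simp add: R'_def)
    fix C z assume C: "finite (C :: nat set set)"
    have R': "(\<forall>r\<in>R'. row_sat d C z r) \<longleftrightarrow>
      z ?i \<le> 1 \<and> 0 \<le> z ?i \<and> 1 \<le> z ?i + sum z J \<and> (\<forall>j\<in>J. z ?i + z j \<le> 1)"
    proof -
      have "row_sat d C z (row {?i, j} 1 1) \<longleftrightarrow> z ?i + z j \<le> 1" if "j \<in> J" for j
        using rs[OF sub(3)[OF that], of C z 1 1] that J by (subst (asm) sum.insert) auto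
      moreover have "row_sat d C z (row (insert ?i J) (-1) (-1)) \<longleftrightarrow> 1 \<le> z ?i + sum z J"
        using J rs[OF sub(2), of C z "-1" "-1"] by simp linarith
      ultimately show ?thesis unfolding R'_def by (auto simp: rs[OF sub(1)])
    qed
    have "(\<forall>r\<in>R'. row_sat d C z r) \<longleftrightarrow> z ?i = of_bool (?g C)"
      if z: "\<forall>i<length xs. z i = of_bool ((xs ! i) C)"
    proof -
      have zJ: "z j = of_bool ((xs ! j) C)" if "j \<in> J" for j using z Nor.hyps that by auto
      show ?thesis
      proof (cases "?g C")
        case True
        then have "\<And>j. j \<in> J \<Longrightarrow> z j = 0" using zJ by auto
        then show ?thesis using True unfolding R' by auto
      next
        case False
        then obtain j where j: "j \<in> J" "z j = 1" using zJ by auto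
        have "z j \<le> sum z J" using j J zJ by (intro member_le_sum) auto
        moreover have "z l \<le> 1" if "l \<in> J" for l using zJ[OF that] by simp
        ultimately show ?thesis using False j unfolding R' by fastforce
      qed
    qed
    then show "(\<forall>r\<in>R \<union> R'. row_sat d C z r) \<longleftrightarrow>
       (\<forall>i<length (xs @ [?g]). z i = of_bool (((xs @ [?g]) ! i) C))"
      unfolding all_less_snoc ball_Un using sat[OF C, of z] by blast
  qed
qed

section \<open>Perfect hash families\<close>

text \<open>By averaging, some \<open>f\<close> is good for at least a fraction \<open>1/K\<close>
  of the still uncovered \<open>Y\<close>; adding it multiplies their number by at most
  \<open>1 - 1/K\<close>. Denominators are cleared to stay in the naturals.\<close>

lemma greedy_cover:
  assumes "finite \<F>" and "finite \<Y>" and "K \<ge> 1" and ne: "\<F> \<noteq> {}"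
    and frac: "\<And>Y. Y \<in> \<Y> \<Longrightarrow> card \<F> \<le> K * card {f \<in> \<F>. ok f Y}"
  shows "\<exists>H\<subseteq>\<F>. card H \<le> t \<and> card {Y \<in> \<Y>. \<forall>f\<in>H. \<not> ok f Y} * K ^ t \<le> card \<Y> * (K - 1) ^ t"
proof (induction t)
  case 0
  show ?case by (intro exI[of _ "{}"]) simp
next
  case (Suc t)
  then obtain H where H: "H \<subseteq> \<F>" "card H \<le> t"
    and c: "card {Y \<in> \<Y>. \<forall>f\<in>H. \<not> ok f Y} * K ^ t \<le> card \<Y> * (K - 1) ^ t" by auto
  define Z where "Z = {Y \<in> \<Y>. \<forall>f\<in>H. \<not> ok f Y}"
  have fZ: "finite Z" using assms(2) by (simp add: Z_def)
  have "\<exists>f\<in>\<F>. card Z \<le> K * card {Y \<in> Z. ok f Y}"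
  proof (rule ccontr)
    assume "\<not> ?thesis"
    then have lt: "K * card {Y \<in> Z. ok f Y} < card Z" if "f \<in> \<F>" for f using that by (simp add: not_le)
    \<comment> \<open>The pairs \<open>(Y, f)\<close> with \<open>Y\<close> in \<open>Z\<close> and
      \<open>ok f Y\<close> are counted in both orders.\<close>
    have "card Z * card \<F> = (\<Sum>Y\<in>Z. card \<F>)" by simp
    also have "\<dots> \<le> (\<Sum>Y\<in>Z. K * card {f \<in> \<F>. ok f Y})"
      using frac by (intro sum_mono) (simp add: Z_def)
    also have "\<dots> = K * (\<Sum>Y\<in>Z. card {f \<in> \<F>. ok f Y})" by (simp add: sum_distrib_left)
    also have "(\<Sum>Y\<in>Z. card {f \<in> \<F>. ok f Y}) = (\<Sum>f\<in>\<F>. card {Y \<in> Z. ok f Y})"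
      using sum_multicount_gen[OF fZ assms(1), of "\<lambda>Y f. ok f Y" "\<lambda>f. card {Y \<in> Z. ok f Y}"] by simp
    also have "K * \<dots> = (\<Sum>f\<in>\<F>. K * card {Y \<in> Z. ok f Y})" by (simp add: sum_distrib_left)
    also have "\<dots> < (\<Sum>f\<in>\<F>. card Z)"
      using assms(1) ne lt by (intro sum_strict_mono) auto
    finally show False by (simp add: mult.commute)
  qed
  then obtain f where f: "f \<in> \<F>" "card Z \<le> K * card {Y \<in> Z. ok f Y}" by blast
  show ?case
  proof (intro exI[of _ "insert f H"] conjI)
    show "insert f H \<subseteq> \<F>" using f H by auto
    show "card (insert f H) \<le> Suc t" using card_insert_le_m1[of "Suc t" H f] H by simp
    have "{Y \<in> \<Y>. \<forall>g\<in>insert f H. \<not> ok g Y} = Z - {Y \<in> Z. ok f Y}" by (auto simp: Z_def)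
    then have r: "card {Y \<in> \<Y>. \<forall>g\<in>insert f H. \<not> ok g Y} = card Z - card {Y \<in> Z. ok f Y}"
      using fZ by (simp add: card_Diff_subset)
    have "(card Z - card {Y \<in> Z. ok f Y}) * K \<le> card Z * (K - 1)"
      using f(2) by (simp add: diff_mult_distrib diff_mult_distrib2 mult.commute)
    then have "(card Z - card {Y \<in> Z. ok f Y}) * K * K ^ t \<le> card Z * (K - 1) * K ^ t"
      by (rule mult_le_mono1)
    also have "\<dots> = (card Z * K ^ t) * (K - 1)" by (simp add: ac_simps)
    also have "\<dots> \<le> (card \<Y> * (K - 1) ^ t) * (K - 1)" using c unfolding Z_def by (rule mult_le_mono1)
    finally show "card {Y \<in> \<Y>. \<forall>g\<in>insert f H. \<not> ok g Y} * K ^ Suc t \<le> card \<Y> * (K - 1) ^ Suc t"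
      unfolding r by (simp add: ac_simps)
  qed
qed

text \<open>\<open>(1 - 1/K) ^ (K * s) \<le> exp (- s) < 2 ^ (- M)\<close>: after
  \<open>K * s\<close> greedy rounds, nothing is left uncovered of a collection of at most
  \<open>2 ^ M\<close> members.\<close>

lemma pred_power_less:
  fixes K s :: nat
  assumes "K \<ge> 1" and "M < s"
  shows "2 ^ M * (K - 1) ^ (K * s) < K ^ (K * s)"
proof -
  have K: "real K > 0" using assms by simp
  have "(real K - 1) / real K \<le> exp (- (1 / real K))"
    using exp_ge_add_one_self[of "- (1 / real K)"] K by (simp add: field_simps)
  then have "((real K - 1) / real K) ^ (K * s) \<le> exp (- (1 / real K)) ^ (K * s)"
    using assms by (intro power_mono) auto
  also have "\<dots> = exp (- real s)"
    using K by (simp flip: exp_of_nat_mult)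
  also have "\<dots> < 1 / 2 ^ M"
  proof -
    have "(2::real) ^ M \<le> exp 1 ^ M" using exp_ge_add_one_self[of 1] by (intro power_mono) auto
    also have "\<dots> = exp (real M)" by (simp flip: exp_of_nat_mult)
    also have "\<dots> < exp (real s)" using assms by simp
    finally show ?thesis by (simp add: exp_minus field_simps)
  qed
  finally have "(real K - 1) ^ (K * s) / real K ^ (K * s) < 1 / 2 ^ M" by (simp add: power_divide)
  then have "2 ^ M * (real K - 1) ^ (K * s) < real K ^ (K * s)"
    using K by (simp add: field_simps)
  then have "real (2 ^ M * (K - 1) ^ (K * s)) < real (K ^ (K * s))"
    using assms by (simp add: of_nat_diff)
  then show ?thesis by (simp only: of_nat_less_iff)
qed

text \<open>With twice as many colours as points to separate, a random colouring is injective on a given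
  set of \<open>q\<close> points with probability at least \<open>2 ^ (- q)\<close>.\<close>

lemma perfect_hash_family:
  fixes U :: "'a set"
  assumes U: "finite U" and q: "q > 0"
  shows "\<exists>H. finite H \<and> card H \<le> 2 ^ q * (card U + 1) \<and> (\<forall>h\<in>H. h ` U \<subseteq> {..<2 * q}) \<and>
    (\<forall>Y\<subseteq>U. card Y \<le> q \<longrightarrow> (\<exists>h\<in>H. inj_on h Y))"
proof -
  define \<F> where "\<F> = U \<rightarrow>\<^sub>E {..<2 * q}"
  define \<Y> where "\<Y> = {Y. Y \<subseteq> U \<and> card Y \<le> q}"
  have fin: "finite \<F>" "finite \<Y>" using U by (auto simp: \<F>_def \<Y>_def intro: finite_PiE)
  have ne: "\<F> \<noteq> {}" using q by (simp add: \<F>_def PiE_eq_empty_iff lessThan_empty_iff)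
  have frac: "card \<F> \<le> 2 ^ q * card {f \<in> \<F>. inj_on f Y}" if "Y \<in> \<Y>" for Y
  proof -
    have Y: "Y \<subseteq> U" "card Y \<le> q" using that by (auto simp: \<Y>_def)
    have cY: "card Y \<le> card U" using Y U card_mono by blast
    \<comment> \<open>The injective colourings of \<open>Y\<close> are counted by the falling
      product of \<open>2 * q - i\<close>. Each factor is at least \<open>q\<close>, half the number
      of colours, since \<open>i < card Y \<le> q\<close>.\<close>
    have "(2 * q) ^ card Y = 2 ^ card Y * q ^ card Y" by (simp add: power_mult_distrib)
    also have "\<dots> \<le> 2 ^ q * q ^ card Y" using Y by (intro mult_le_mono1 power_increasing) auto
    also have "q ^ card Y = (\<Prod>i\<in>{0..<card Y}. q)" by simp
    also have "\<dots> \<le> (\<Prod>i\<in>{0..<card Y}. 2 * q - i)" using Y by (intro prod_mono) auto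
    finally have *: "(2 * q) ^ card Y \<le> 2 ^ q * (\<Prod>i\<in>{0..<card Y}. 2 * q - i)" by simp
    have "card \<F> = (2 * q) ^ (card U - card Y) * (2 * q) ^ card Y"
      unfolding \<F>_def power_add[symmetric] using U cY by (simp add: card_PiE)
    also have "\<dots> \<le> (2 * q) ^ (card U - card Y) * (2 ^ q * (\<Prod>i\<in>{0..<card Y}. 2 * q - i))"
      using * by (rule mult_le_mono2)
    also have "\<dots> = 2 ^ q * card {f \<in> \<F>. inj_on f Y}"
      unfolding \<F>_def using card_inj_on_subset_funcset[OF U _ Y(1), of "{..<2 * q}"] by simp
    finally show ?thesis .
  qed
  \<comment> \<open>Enough greedy rounds, with \<open>K = 2 ^ q\<close>, to push the number of
    unseparated sets, initially at most \<open>2 ^ card U\<close>, below one.\<close>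
  define t where "t = 2 ^ q * (card U + 1)"
  obtain H where H: "H \<subseteq> \<F>" "card H \<le> t"
    and c: "card {Y \<in> \<Y>. \<forall>f\<in>H. \<not> inj_on f Y} * (2 ^ q) ^ t \<le> card \<Y> * (2 ^ q - 1) ^ t"
    using greedy_cover[where t = t and ok = "\<lambda>f Y. inj_on f Y", OF fin _ ne frac] by auto
  have "card \<Y> \<le> card (Pow U)" using U by (intro card_mono) (auto simp: \<Y>_def)
  then have "card \<Y> \<le> 2 ^ card U" using U by (simp add: card_Pow)
  then have "card \<Y> * (2 ^ q - 1) ^ t \<le> 2 ^ card U * (2 ^ q - 1) ^ t" by (rule mult_le_mono1)
  also have "\<dots> < (2 ^ q) ^ t" unfolding t_def by (rule pred_power_less) auto
  finally have "card {Y \<in> \<Y>. \<forall>f\<in>H. \<not> inj_on f Y} * (2 ^ q) ^ t < 1 * (2 ^ q) ^ t" using c by linarith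
  then have "card {Y \<in> \<Y>. \<forall>f\<in>H. \<not> inj_on f Y} < 1" by (simp only: mult_less_cancel2)
  then have "{Y \<in> \<Y>. \<forall>f\<in>H. \<not> inj_on f Y} = {}" using fin by simp
  then have "\<forall>Y\<subseteq>U. card Y \<le> q \<longrightarrow> (\<exists>h\<in>H. inj_on h Y)" by (auto simp: \<Y>_def)
  moreover have "finite H" using H fin finite_subset by auto
  moreover have "\<forall>h\<in>H. h ` U \<subseteq> {..<2 * q}" using H by (auto simp: \<F>_def)
  ultimately show ?thesis using H unfolding t_def by blast
qed

section \<open>Small dense subgraphs\<close>

text \<open>\<open>X\<close> holds the edges used, \<open>F\<close> the vertices carrying tokens,
  \<open>l\<close> the number of moves. As \<open>F\<close> is a set, tokens that meet merge by
  themselves; a loop, \<open>u = v\<close>, uses up an edge and leaves \<open>F\<close> as it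
  is.\<close>

inductive token_search :: "('e \<Rightarrow> 'v set) \<Rightarrow> 'e set \<Rightarrow> nat \<Rightarrow> 'e set \<Rightarrow> 'v set \<Rightarrow> bool"
  for p E where
  start: "e \<in> E \<Longrightarrow> e' \<in> E \<Longrightarrow> e \<noteq> e' \<Longrightarrow> token_search p E 0 {e, e'} (p e \<union> p e')"
| move: "token_search p E l X F \<Longrightarrow> b \<in> E \<Longrightarrow> b \<notin> X \<Longrightarrow> v \<in> F \<Longrightarrow> p b = {u, v}
    \<Longrightarrow> token_search p E (Suc l) (insert b X) (insert u (F - {v}))"

text \<open>Take \<open>V\<close> of least size among the sets spanning more than
  \<open>2 * card V\<close> edges: deleting a vertex that lies on at most two of them would leave a
  smaller such set. The empty set spans no edge, so \<open>V\<close> is nonempty.\<close>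

lemma dense_core:
  assumes "finite A" and "finite E" and ne: "\<And>e. e \<in> E \<Longrightarrow> p e \<noteq> {}"
    and sub: "\<And>e. e \<in> E \<Longrightarrow> p e \<subseteq> A" and big: "2 * card A < card E"
  shows "\<exists>V\<subseteq>A. V \<noteq> {} \<and> (\<forall>v\<in>V. 3 \<le> card {e \<in> E. p e \<subseteq> V \<and> v \<in> p e})"
proof -
  define dense where "dense V \<longleftrightarrow> V \<subseteq> A \<and> 2 * card V < card {e \<in> E. p e \<subseteq> V}" for V
  have "{e \<in> E. p e \<subseteq> A} = E" using sub by auto
  then have "dense A" using big by (simp add: dense_def)
  then obtain V where V: "dense V" and min: "\<And>W. dense W \<Longrightarrow> card V \<le> card W"
    using ex_has_least_nat[of dense A card] by blast
  have fV: "finite V" using V assms(1) finite_subset by (auto simp: dense_def)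
  have "V \<noteq> {}"
  proof
    assume "V = {}"
    then have "{e \<in> E. p e \<subseteq> V} = {}" using ne by auto
    then have "card {e \<in> E. p e \<subseteq> V} = 0" by (simp only: card.empty)
    with V show False unfolding dense_def by linarith
  qed
  moreover have "3 \<le> card {e \<in> E. p e \<subseteq> V \<and> v \<in> p e}" if v: "v \<in> V" for v
  proof -
    have c: "card (V - {v}) < card V" using v fV by (meson card_Diff1_less)
    then have "\<not> dense (V - {v})" using min[of "V - {v}"] by auto
    then have le: "card {e \<in> E. p e \<subseteq> V - {v}} \<le> 2 * card (V - {v})"
      using V by (auto simp: dense_def)
    have "{e \<in> E. p e \<subseteq> V} = {e \<in> E. p e \<subseteq> V - {v}} \<union> {e \<in> E. p e \<subseteq> V \<and> v \<in> p e}" by auto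
    then have "card {e \<in> E. p e \<subseteq> V} \<le> card {e \<in> E. p e \<subseteq> V - {v}} + card {e \<in> E. p e \<subseteq> V \<and> v \<in> p e}"
      by (metis (no_types, lifting) card_Un_le)
    with le c V show ?thesis unfolding dense_def by linarith
  qed
  ultimately show ?thesis using V by (auto simp: dense_def)
qed

text \<open>A token is moved along the edge from its vertex to the parent; moving a deepest token
  first ensures that no edge is used twice.\<close>

lemma tokens_merge:
  fixes dep :: "'v \<Rightarrow> nat" and pe :: "'v \<Rightarrow> 'e" and pv :: "'v \<Rightarrow> 'v"
  assumes pe: "\<And>v. v \<in> S \<Longrightarrow> v \<noteq> r \<Longrightarrow> pe v \<in> E \<and> p (pe v) = {pv v, v} \<and> pv v \<in> S \<and> dep (pv v) < dep v"
    and fresh: "\<And>v. v \<in> S \<Longrightarrow> v \<noteq> r \<Longrightarrow> pe v \<notin> X\<^sub>0"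
  shows "token_search p E l (X\<^sub>0 \<union> pe ` M) F \<Longrightarrow> finite F \<Longrightarrow> F \<subseteq> S \<Longrightarrow> M \<subseteq> S - {r} \<Longrightarrow> M \<inter> F = {}
    \<Longrightarrow> (\<forall>w\<in>M. \<forall>f\<in>F. dep f \<le> dep w) \<Longrightarrow>
    \<exists>l' X F'. token_search p E l' X F' \<and> card F' \<le> 1 \<and> l' \<le> l + sum dep F"
\<comment> \<open>Every move lowers the total depth of the tokens, which bounds the number of moves.
  \<open>M\<close> holds the vertices left so far; they are at least as deep as every token, so no
  token moves back into \<open>M\<close> and no parent edge is used again.\<close>
proof (induction "sum dep F" arbitrary: l M F rule: less_induct)
  case less
  show ?case
  proof (cases "F \<subseteq> {r}")
    case True
    then have "card F \<le> 1" using card_mono[of "{r}" F] by auto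
    with less.prems(1) show ?thesis using le_add1 by blast
  next
    case False
    then have F0: "F - {r} \<noteq> {}" by auto
    define v where "v = (ARG_MAX dep x. x \<in> F - {r})"
    have arg: "v \<in> F - {r}" "\<And>x. x \<in> F - {r} \<Longrightarrow> dep x \<le> dep v"
    proof -
      obtain x where "x \<in> F - {r}" using F0 by auto
      moreover have "\<forall>y. y \<in> F - {r} \<longrightarrow> dep y < Suc (Max (dep ` F))"
        using less.prems(2) by (simp add: le_imp_less_Suc)
      ultimately show "v \<in> F - {r}" "\<And>x. x \<in> F - {r} \<Longrightarrow> dep x \<le> dep v"
        unfolding v_def using arg_max_nat_lemma[of "\<lambda>x. x \<in> F - {r}" x dep] by blast+
    qed
    have vS: "v \<in> S" "v \<noteq> r" using arg less.prems(3) by auto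
    note pv = pe[OF vS]
    have maxd: "dep f \<le> dep v" if f: "f \<in> F" for f
    proof (cases "f = r")
      case True
      \<comment> \<open>The root was left out of the maximum. Following parents from
        \<open>v\<close> strictly lowers the depth and can only stop at \<open>r\<close>, so
        \<open>r\<close> is no deeper than \<open>v\<close>.\<close>
      have "\<exists>u\<in>S. dep u \<le> dep v \<and> u = r"
      proof -
        have "x \<in> S \<Longrightarrow> \<exists>u\<in>S. dep u \<le> dep x \<and> u = r" for x
          by (induction "dep x" arbitrary: x rule: less_induct)
             (metis less_imp_le_nat order_refl order_trans pe)
        then show ?thesis using vS by auto
      qed
      then show ?thesis using True by auto
    next
      case False
      then show ?thesis using arg f by auto
    qed
    define u where "u = pv v"
    let ?F = "insert u (F - {v})" and ?M = "insert v M"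
    \<comment> \<open>Two distinct vertices with the same parent edge would be parents of each
      other, against the strict decrease of depth.\<close>
    have inj: "pe v \<noteq> pe w" if w: "w \<in> M" for w
    proof
      assume eq: "pe v = pe w"
      have wS: "w \<in> S" "w \<noteq> r" using w less.prems(4) by auto
      have "{pv v, v} = {pv w, w}" using pe[OF wS] pv eq by auto
      moreover have "v \<noteq> w" using w less.prems(5) arg by auto
      ultimately have "v = pv w" "w = pv v" by (auto simp: doubleton_eq_iff)
      then show False using pe[OF wS] pv by auto
    qed
    have ns: "token_search p E (Suc l) (insert (pe v) (X\<^sub>0 \<union> pe ` M)) ?F"
      using less.prems(1)
    proof (rule token_search.move)
      show "pe v \<in> E" using pv by auto
      show "pe v \<notin> X\<^sub>0 \<union> pe ` M" using fresh[OF vS] inj by auto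
      show "v \<in> F" using arg by auto
      show "p (pe v) = {u, v}" using pv by (auto simp: u_def)
    qed
    have sm: "sum dep ?F < sum dep F"
    proof -
      have "sum dep ?F \<le> dep u + sum dep (F - {v})"
        using less.prems(2) by (simp add: sum.insert_if)
      also have "\<dots> < dep v + sum dep (F - {v})" using pv by (simp add: u_def)
      also have "\<dots> = sum dep F" using arg less.prems(2) by (simp add: sum.remove[of F v])
      finally show ?thesis .
    qed
    have "\<exists>l' X F'. token_search p E l' X F' \<and> card F' \<le> 1 \<and> l' \<le> Suc l + sum dep ?F"
    proof (rule less.hyps[OF sm])
      show "token_search p E (Suc l) (X\<^sub>0 \<union> pe ` ?M) ?F" using ns by simp
      show "finite ?F" using less.prems(2) by auto
      show "?F \<subseteq> S" using less.prems(3) pv by (auto simp: u_def)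
      show "?M \<subseteq> S - {r}" using less.prems(4) vS by auto
      have "u \<noteq> v" using pv by (auto simp: u_def)
      moreover have "u \<notin> M" using less.prems(6) arg pv by (fastforce simp: u_def)
      ultimately show "?M \<inter> ?F = {}" using less.prems(5) by auto
      have "dep u \<le> dep v" using pv by (simp add: u_def)
      then show "\<forall>w\<in>?M. \<forall>f\<in>?F. dep f \<le> dep w"
        using less.prems(6) maxd arg by (auto intro: order_trans)
    qed
    then obtain l' X F' where "token_search p E l' X F'" "card F' \<le> 1" "l' \<le> Suc l + sum dep ?F"
      by blast
    moreover have "Suc l + sum dep ?F \<le> l + sum dep F" using sm by linarith
    ultimately show ?thesis using order_trans by blast
  qed
qed

text \<open>In a breadth-first tree of the dense core, at most one non-tree edge up to radius
  \<open>d\<close> would make the balls double at each step and outgrow \<open>A\<close>. So the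
  ball of radius \<open>d\<close> contains two non-tree edges; they have at most four ends, each of
  depth at most \<open>d\<close>, whence \<open>4 * d\<close> moves.\<close>

lemma token_search_complete:
  fixes p :: "'e \<Rightarrow> 'v set"
  assumes A: "finite A" and E: "finite E"
    and ne: "\<And>e. e \<in> E \<Longrightarrow> p e \<noteq> {}" and sub: "\<And>e. e \<in> E \<Longrightarrow> p e \<subseteq> A"
    and two: "\<And>e. e \<in> E \<Longrightarrow> card (p e) \<le> 2"
    and big: "2 * card A < card E" and lam: "card A < 2 ^ d"
  shows "\<exists>l X F. token_search p E l X F \<and> card F \<le> 1 \<and> l \<le> 4 * d"
proof -
  obtain V where VA: "V \<subseteq> A" and V0: "V \<noteq> {}"
    and deg: "\<And>v. v \<in> V \<Longrightarrow> 3 \<le> card {e \<in> E. p e \<subseteq> V \<and> v \<in> p e}"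
    using dense_core[of A E p, OF A E ne sub big] by metis
  define D where "D = {e \<in> E. p e \<subseteq> V}"
  have D: "finite D" "\<And>e. e \<in> D \<Longrightarrow> p e \<subseteq> V" "\<And>e. e \<in> D \<Longrightarrow> e \<in> E" using E by (auto simp: D_def)
  have fp: "finite (p e)" if "e \<in> D" for e using that D(2) VA A by (meson finite_subset)
  obtain r where r: "r \<in> V" using V0 by auto
  \<comment> \<open>\<open>S i\<close> is the ball of radius \<open>i\<close> about \<open>r\<close>
    in the core. Below, \<open>dep\<close> is the distance from \<open>r\<close>, meaningful only
    for vertices in some ball.\<close>
  define S where "S = rec_nat {r} (\<lambda>_ T. T \<union> \<Union>{p e |e. e \<in> D \<and> p e \<inter> T \<noteq> {}})"
  have S0: "S 0 = {r}" by (simp add: S_def)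
  have SS: "S (Suc i) = S i \<union> \<Union>{p e |e. e \<in> D \<and> p e \<inter> S i \<noteq> {}}" for i by (simp add: S_def)
  have SV: "S i \<subseteq> V" for i by (induction i) (use r D in \<open>auto simp: S0 SS\<close>)
  have fS: "finite (S i)" for i using SV VA A by (meson finite_subset)
  have Smono: "i \<le> j \<Longrightarrow> S i \<subseteq> S j" for i j by (rule lift_Suc_mono_le) (auto simp: SS)
  define dep where "dep v = (LEAST i. v \<in> S i)" for v
  have dep: "v \<in> S (dep v)" "dep v \<le> i" if "v \<in> S i" for v i
    using that unfolding dep_def by (rule LeastI, rule Least_le)
  have parent: "\<exists>e u. e \<in> D \<and> p e = {u, v} \<and> u \<in> S i \<and> dep u < dep v" if v: "v \<in> S i" "v \<noteq> r" for v i
  proof -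
    have "dep v \<noteq> 0"
    proof
      assume "dep v = 0"
      then have "v \<in> S 0" using dep(1)[OF v(1)] by metis
      then show False using v(2) S0 by blast
    qed
    then obtain j where j: "dep v = Suc j" using not0_implies_Suc by blast
    then have nj: "v \<notin> S j" using dep(2)[of v j] by linarith
    with dep(1)[OF v(1)] obtain e u where e: "e \<in> D" "v \<in> p e" "u \<in> p e" "u \<in> S j"
      unfolding j SS by blast
    have uv: "u \<noteq> v" using nj e by auto
    have "p e = {u, v}"
    proof (rule sym, rule card_seteq)
      show "finite (p e)" using fp e by auto
      show "{u, v} \<subseteq> p e" using e by auto
      show "card (p e) \<le> card {u, v}" using two[of e] D(3)[OF e(1)] uv by auto
    qed
    moreover have "dep u < dep v" using dep(2)[OF e(4)] j by auto
    moreover have "u \<in> S i" using e(4) Smono[of j i] dep(2)[OF v(1)] j by auto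
    ultimately show ?thesis using e by blast
  qed
  have "\<forall>v. \<exists>e u. v \<in> S d \<and> v \<noteq> r \<longrightarrow> e \<in> D \<and> p e = {u, v} \<and> u \<in> S d \<and> dep u < dep v"
    using parent by blast
  then obtain pe pv where pepv: "\<And>v. v \<in> S d \<Longrightarrow> v \<noteq> r \<Longrightarrow>
      pe v \<in> D \<and> p (pe v) = {pv v, v} \<and> pv v \<in> S d \<and> dep (pv v) < dep v"
    by metis
  define Tr where "Tr = pe ` (S d - {r})"
  define N where "N i = {e \<in> D. p e \<subseteq> S i}" for i
  have fN: "finite (N i)" for i using D by (auto simp: N_def)
  have "\<not> card (N d - Tr) \<le> 1"
  proof
    assume one: "card (N d - Tr) \<le> 1"
    \<comment> \<open>An edge inside \<open>S i\<close> is either the at most one non-tree edge or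
      the parent edge of a vertex of \<open>S i\<close> other than \<open>r\<close>.\<close>
    have Nle: "card (N i) \<le> card (S i)" if "i \<le> d" for i
    proof -
      have "N i \<subseteq> (N d - Tr) \<union> pe ` (S i - {r})"
      proof
        fix e assume e: "e \<in> N i"
        then have "e \<in> N d" using Smono[OF that] by (auto simp: N_def)
        moreover have "e \<in> pe ` (S i - {r})" if "e \<in> Tr"
        proof -
          from that obtain v where v: "v \<in> S d" "v \<noteq> r" "e = pe v" by (auto simp: Tr_def)
          then have "v \<in> p e" using pepv by auto
          then show ?thesis using v e by (auto simp: N_def)
        qed
        ultimately show "e \<in> (N d - Tr) \<union> pe ` (S i - {r})" by auto
      qed
      then have "card (N i) \<le> card ((N d - Tr) \<union> pe ` (S i - {r}))"
        using fN fS by (intro card_mono) auto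
      also have "\<dots> \<le> card (N d - Tr) + card (pe ` (S i - {r}))" by (rule card_Un_le)
      also have "\<dots> \<le> 1 + card (S i - {r})" using one card_image_le[of "S i - {r}" pe] fS by (meson add_mono finite_Diff)
      also have "\<dots> = card (S i)"
      proof -
        have "r \<in> S i" using Smono[of 0 i] S0 by auto
        then show ?thesis using fS by (metis card_Suc_Diff1 plus_1_eq_Suc)
      qed
      finally show ?thesis .
    qed
    \<comment> \<open>Count incidences with \<open>S i\<close>. Degrees are at least 3, every
      incident edge lies in \<open>N (Suc i)\<close>, and only edges of \<open>N i\<close> can count
      twice; so three times the ball is at most \<open>card (N (Suc i)) + card (N i)\<close>, to
      which \<open>Nle\<close> applies.\<close>
    have double: "2 * card (S i) \<le> card (S (Suc i))" if i: "Suc i \<le> d" for i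
    proof -
      have inN: "e \<in> N (Suc i)" if "e \<in> D" "v \<in> p e" "v \<in> S i" for e v
        using that unfolding N_def SS by blast
      have "3 * card (S i) \<le> (\<Sum>v\<in>S i. card {e \<in> D. v \<in> p e})"
      proof -
        have "3 \<le> card {e \<in> D. v \<in> p e}" if "v \<in> S i" for v
          using deg[of v] SV[of i] that by (auto simp: D_def conj_assoc)
        then have "(\<Sum>v\<in>S i. 3) \<le> (\<Sum>v\<in>S i. card {e \<in> D. v \<in> p e})" by (intro sum_mono)
        then show ?thesis by simp
      qed
      also have "\<dots> = (\<Sum>v\<in>S i. card {e \<in> N (Suc i). v \<in> p e})"
      proof (rule sum.cong)
        fix v assume "v \<in> S i"
        then have "{e \<in> D. v \<in> p e} = {e \<in> N (Suc i). v \<in> p e}" using inN by (auto simp: N_def)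
        then show "card {e \<in> D. v \<in> p e} = card {e \<in> N (Suc i). v \<in> p e}" by simp
      qed simp
      also have "\<dots> = (\<Sum>e\<in>N (Suc i). card {v \<in> S i. v \<in> p e})"
        using sum_multicount_gen[OF fS[of i] fN[of "Suc i"], of "\<lambda>v e. v \<in> p e" "\<lambda>e. card {v \<in> S i. v \<in> p e}"] by simp
      also have "\<dots> \<le> (\<Sum>e\<in>N (Suc i). 1 + (if p e \<subseteq> S i then 1 else 0))"
      proof (rule sum_mono)
        fix e assume e: "e \<in> N (Suc i)"
        then have eD: "e \<in> D" by (auto simp: N_def)
        then have c2: "card (p e) \<le> 2" using two D by auto
        show "card {v \<in> S i. v \<in> p e} \<le> 1 + (if p e \<subseteq> S i then 1 else 0)"
        proof (cases "p e \<subseteq> S i")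
          case True
          have "card {v \<in> S i. v \<in> p e} \<le> card (p e)" using fp[OF eD] by (intro card_mono) auto
          then show ?thesis using True c2 by simp
        next
          case False
          have "card {v \<in> S i. v \<in> p e} < card (p e)" using fp[OF eD] False by (intro psubset_card_mono) auto
          then show ?thesis using False c2 by simp
        qed
      qed
      also have "\<dots> = card (N (Suc i)) + card {e \<in> N (Suc i). p e \<subseteq> S i}"
        unfolding sum.distrib using fN by (simp add: sum.If_cases Int_def)
      also have "\<dots> \<le> card (N (Suc i)) + card (N i)"
        using fN by (intro add_left_mono card_mono) (auto simp: N_def)
      also have "\<dots> \<le> card (S (Suc i)) + card (S i)" using Nle i by (intro add_mono) auto
      finally show ?thesis by simp
    qed
    have "i \<le> d \<Longrightarrow> 2 ^ i \<le> card (S i)" for i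
    proof (induction i)
      case (Suc i)
      then show ?case using double[of i] by auto
    qed (simp add: S0)
    from this[of d] have "2 ^ d \<le> card (S d)" by simp
    also have "\<dots> \<le> card A" using SV VA A by (intro card_mono) auto
    finally show False using lam by simp
  qed
  then have "\<exists>e e'. e \<in> N d - Tr \<and> e' \<in> N d - Tr \<and> e \<noteq> e'"
    by (metis card_le_Suc0_iff_eq fN finite_Diff One_nat_def)
  then obtain e e' where e: "e \<in> N d - Tr" "e' \<in> N d - Tr" "e \<noteq> e'" by blast
  let ?F = "p e \<union> p e'"
  have eE: "e \<in> E" "e' \<in> E" "e \<in> D" "e' \<in> D" using e D by (auto simp: N_def)
  have FS: "?F \<subseteq> S d" using e by (auto simp: N_def)
  have "\<exists>l' X F'. token_search p E l' X F' \<and> card F' \<le> 1 \<and> l' \<le> 0 + sum dep ?F"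
  proof (rule tokens_merge[where S = "S d" and r = r and pe = pe and pv = pv and X\<^sub>0 = "{e, e'}" and M = "{}"])
    show "pe v \<in> E \<and> p (pe v) = {pv v, v} \<and> pv v \<in> S d \<and> dep (pv v) < dep v" if "v \<in> S d" "v \<noteq> r" for v
      using pepv[OF that] D by auto
    show "pe v \<notin> {e, e'}" if "v \<in> S d" "v \<noteq> r" for v
      using e that by (auto simp: Tr_def)
    show "token_search p E 0 ({e, e'} \<union> pe ` {}) ?F"
      using token_search.start[of e E e' p] eE e by simp
  qed (use FS fp eE in auto)
  moreover have "sum dep ?F \<le> 4 * d"
  proof -
    have "sum dep ?F \<le> card ?F * d"
      using FS dep(2) by (metis of_nat_id subsetD sum_bounded_above)
    moreover have "card ?F \<le> 4" using card_Un_le[of "p e" "p e'"] two[OF eE(1)] two[OF eE(2)] by linarith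
    ultimately show ?thesis by (meson mult_le_mono1 order_trans)
  qed
  ultimately show ?thesis by (metis add_0 order_trans)
qed

section \<open>Improvements by colour coding\<close>

text \<open>A nonempty member of \<open>A\<close> is its own neighbour, so packings that overlap
  \<open>A\<close> are treated uniformly.\<close>

definition nbrs :: "nat set set \<Rightarrow> nat set \<Rightarrow> nat set set" where
  "nbrs A b = {a \<in> A. a \<inter> b \<noteq> {}}"

lemma nbrs_subset: "nbrs A b \<subseteq> A" by (auto simp: nbrs_def)

text \<open>Two starting sets with at most two neighbours each occupy at most four vertices, and a
  move never increases the number of tokens.\<close>

definition fronts :: "nat set set \<Rightarrow> nat set set set" where
  "fronts T = {F. F \<subseteq> T \<and> card F \<le> 4}"

text \<open>A state consists of the positions of the tokens and the colours of the elements covered so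
  far. Since used sets are only remembered by their colours, there are few states; since their
  colours are disjoint, so are the sets.\<close>

fun reach :: "nat set set \<Rightarrow> (nat \<Rightarrow> nat) \<Rightarrow> nat set set \<Rightarrow> nat set set \<Rightarrow> nat
    \<Rightarrow> (nat set set \<times> nat set) set" where
  "reach T h A C 0 = {(F, h ` e \<union> h ` e') | F e e'. F \<in> fronts T \<and> e \<in> C \<and> e' \<in> C \<and>
     h ` e \<inter> h ` e' = {} \<and> nbrs A e \<subseteq> F \<and> nbrs A e' \<subseteq> F}"
| "reach T h A C (Suc l) = {(insert u (F - {v}), D \<union> h ` b) | F D b u v. (F, D) \<in> reach T h A C l \<and>
     b \<in> C \<and> u \<in> T \<and> v \<in> F \<and> h ` b \<inter> D = {} \<and> nbrs A b \<subseteq> {u, v}}"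

text \<open>After \<open>l\<close> moves \<open>l + 2\<close> sets are in use, while their
  neighbours are covered by the remaining token and at most \<open>l\<close> vertices that were
  left: an exchange gains. The first disjunct covers a set that can be added outright.\<close>

definition improvable :: "nat set set \<Rightarrow> (nat \<Rightarrow> nat) set \<Rightarrow> nat \<Rightarrow> nat set set \<Rightarrow> nat set set \<Rightarrow> bool" where
  "improvable T H L A C \<longleftrightarrow> (\<exists>e\<in>C. nbrs A e = {}) \<or>
     (\<exists>h\<in>H. \<exists>l\<le>L. \<exists>(F, D)\<in>reach T h A C l. card F \<le> 1)"

section \<open>Monotonicity and soundness of the search\<close>

lemma reach_mono:
  assumes "C \<subseteq> C'"
  shows "x \<in> reach T h A C l \<Longrightarrow> x \<in> reach T h A C' l"
proof (induction l arbitrary: x)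
  case 0
  then obtain F e e' where "x = (F, h ` e \<union> h ` e')" "F \<in> fronts T" "e \<in> C" "e' \<in> C"
    "h ` e \<inter> h ` e' = {}" "nbrs A e \<subseteq> F" "nbrs A e' \<subseteq> F" by auto
  moreover from this have "e \<in> C'" "e' \<in> C'" using assms by auto
  ultimately show ?case unfolding reach.simps by blast
next
  case (Suc l)
  then obtain F D b u v where "x = (insert u (F - {v}), D \<union> h ` b)" and F: "(F, D) \<in> reach T h A C l"
    "b \<in> C" "u \<in> T" "v \<in> F" "h ` b \<inter> D = {}" "nbrs A b \<subseteq> {u, v}" by auto
  moreover have "(F, D) \<in> reach T h A C' l" "b \<in> C'" using Suc.IH[OF F(1)] F(2) assms by auto
  ultimately show ?case unfolding reach.simps by blast
qed

text \<open>Monotonicity in the available sets is what makes one pruning pass end in an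
  inclusion-minimal improvable family.\<close>

lemma improvable_mono:
  assumes "improvable T H L A C" and "C \<subseteq> C'"
  shows "improvable T H L A C'"
  using assms(1) reach_mono[OF assms(2)] assms(2) unfolding improvable_def by (meson case_prodE case_prodI subsetD)

lemma reach_fronts:
  assumes "finite T"
  shows "(F, D) \<in> reach T h A C l \<Longrightarrow> F \<in> fronts T"
proof (induction l arbitrary: F D)
  case (Suc l)
  then obtain F' D' b u v where F': "(F', D') \<in> reach T h A C l" "u \<in> T" "v \<in> F'" "F = insert u (F' - {v})"
    by auto
  have f: "F' \<subseteq> T" "card F' \<le> 4" using Suc.IH[OF F'(1)] by (auto simp: fronts_def)
  have "card F \<le> Suc (card (F' - {v}))" unfolding F'(4) by (rule card_insert_le_m1) auto
  also have "\<dots> = card F'" using F'(3) finite_subset[OF f(1) assms] by (rule card_Suc_Diff1[rotated])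
  finally have "card F \<le> card F'" .
  then show ?case using f F' by (auto simp: fronts_def)
qed auto

text \<open>Together with \<open>reach_fronts\<close> this confines the reachable states to a small
  set that a circuit can enumerate.\<close>

lemma reach_colours: "(F, D) \<in> reach T h A C l \<Longrightarrow> D \<subseteq> h ` \<Union>C"
proof (induction l arbitrary: F D)
  case (Suc l)
  then obtain F' D' b where s: "(F', D') \<in> reach T h A C l" "b \<in> C" "D = D' \<union> h ` b" by auto
  have "h ` b \<subseteq> h ` \<Union>C" using s(2) by (intro image_mono Union_upper)
  then show ?case using Suc.IH[OF s(1)] s(3) by simp
next
  case 0
  then obtain e e' where s: "e \<in> C" "e' \<in> C" "D = h ` e \<union> h ` e'" by auto
  have "h ` e \<subseteq> h ` \<Union>C" "h ` e' \<subseteq> h ` \<Union>C" using s by (intro image_mono Union_upper; simp)+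
  then show ?case using s(3) by simp
qed

text \<open>Sets with disjoint colours are disjoint, and being nonempty they are distinct, which
  gives \<open>l + 2\<close> of them. \<open>Z\<close> collects the vertices that tokens have left,
  at most one for each move. The state is reached from \<open>X\<close> alone, so \<open>X\<close>
  inherits improvability.\<close>

lemma reach_sound:
  assumes "finite T" and ne: "\<And>S. S \<in> C \<Longrightarrow> S \<noteq> {}"
  shows "(F, D) \<in> reach T h A C l \<Longrightarrow> \<exists>X\<subseteq>C. (F, D) \<in> reach T h A X l \<and> finite X \<and> card X = l + 2 \<and>
    disjoint X \<and> D = h ` \<Union>X \<and> (\<exists>Z. finite Z \<and> card Z \<le> l \<and> (\<Union>b\<in>X. nbrs A b) \<subseteq> F \<union> Z)"
proof (induction l arbitrary: F D)
  case 0
  then obtain e e' where e: "e \<in> C" "e' \<in> C" "h ` e \<inter> h ` e' = {}" "D = h ` e \<union> h ` e'"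
      "F \<in> fronts T" "nbrs A e \<subseteq> F" "nbrs A e' \<subseteq> F" by auto
  then have d: "e \<inter> e' = {}" by auto
  then have n: "e \<noteq> e'" using ne e by auto
  show ?case
  proof (rule exI[of _ "{e, e'}"], intro conjI)
    show "(F, D) \<in> reach T h A {e, e'} 0" using e by auto
    show "disjoint {e, e'}" using d by (auto simp: disjoint_def)
    show "\<exists>Z. finite Z \<and> card Z \<le> 0 \<and> (\<Union>b\<in>{e, e'}. nbrs A b) \<subseteq> F \<union> Z"
      using e(6,7) by (intro exI[of _ "{}"]) auto
    show "D = h ` \<Union>{e, e'}" using e(4) by auto
  qed (use e(1,2) n in auto)
next
  case (Suc l)
  then obtain F' D' b u v where s: "(F', D') \<in> reach T h A C l" "b \<in> C" "u \<in> T" "v \<in> F'"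
    "h ` b \<inter> D' = {}" "nbrs A b \<subseteq> {u, v}" "F = insert u (F' - {v})" "D = D' \<union> h ` b" by auto
  obtain X Z where X: "X \<subseteq> C" "(F', D') \<in> reach T h A X l" "finite X" "card X = l + 2" "disjoint X"
    "D' = h ` \<Union>X" and Z: "finite Z" "card Z \<le> l" "(\<Union>b\<in>X. nbrs A b) \<subseteq> F' \<union> Z"
    using Suc.IH[OF s(1)] by blast
  have d: "b \<inter> \<Union>X = {}" using s(5) unfolding X(6) by auto
  then have n: "b \<notin> X" using ne[OF s(2)] by blast
  show ?case
  proof (rule exI[of _ "insert b X"], intro conjI)
    have "(F', D') \<in> reach T h A (insert b X) l" by (rule reach_mono[OF _ X(2)]) auto
    then show "(F, D) \<in> reach T h A (insert b X) (Suc l)"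
      unfolding reach.simps using s by blast
    show "disjoint (insert b X)" using d X by (auto simp: pairwise_insert disjnt_def)
    show "\<exists>Z. finite Z \<and> card Z \<le> Suc l \<and> (\<Union>b\<in>insert b X. nbrs A b) \<subseteq> F \<union> Z"
    proof (intro exI[of _ "insert v Z"] conjI)
      show "(\<Union>b\<in>insert b X. nbrs A b) \<subseteq> F \<union> insert v Z" using Z(3) s(6,7) by blast
    qed (use Z in \<open>auto simp: card_insert_if\<close>)
    show "D = h ` \<Union>(insert b X)" using s(8) X(6) by auto
    show "card (insert b X) = Suc l + 2" using X(3,4) n by simp
  qed (use X(1,3) s(2) in auto)
qed

lemma improvable_sound:
  assumes T: "finite T" and ne: "\<And>S. S \<in> C \<Longrightarrow> S \<noteq> {}" and imp: "improvable T H L A C"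
  shows "\<exists>X\<subseteq>C. finite X \<and> disjoint X \<and> card (\<Union>b\<in>X. nbrs A b) < card X \<and> improvable T H L A X"
proof (cases "\<exists>e\<in>C. nbrs A e = {}")
  case True
  then obtain e where "e \<in> C" "nbrs A e = {}" by blast
  then show ?thesis by (intro exI[of _ "{e}"]) (auto simp: improvable_def)
next
  case False
  then obtain h l F D where h: "h \<in> H" "l \<le> L" "(F, D) \<in> reach T h A C l" "card F \<le> 1"
    using imp unfolding improvable_def by blast
  obtain X Z where X: "X \<subseteq> C" "(F, D) \<in> reach T h A X l" "finite X" "card X = l + 2" "disjoint X"
    and Z: "finite Z" "card Z \<le> l" "(\<Union>b\<in>X. nbrs A b) \<subseteq> F \<union> Z"
    using reach_sound[OF T ne h(3)] by blast
  have "finite F" using reach_fronts[OF T h(3)] T finite_subset by (auto simp: fronts_def)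
  then have "card (\<Union>b\<in>X. nbrs A b) \<le> card (F \<union> Z)" using Z by (intro card_mono) auto
  also have "\<dots> \<le> card F + card Z" by (rule card_Un_le)
  finally have "card (\<Union>b\<in>X. nbrs A b) < card X" using X Z h by linarith
  moreover have "improvable T H L A X" unfolding improvable_def using h X by blast
  ultimately show ?thesis using X by blast
qed

section \<open>Completeness of the search and the ratio at a local optimum\<close>

lemma token_search_props:
  "token_search p E l X F \<Longrightarrow> X \<subseteq> E \<and> finite X \<and> card X = l + 2"
  by (induction rule: token_search.induct) auto

text \<open>If \<open>h\<close> separates all elements of the sets used, then disjoint sets of the
  packing have disjoint colours, and no move is blocked.\<close>

lemma reach_complete:
  assumes AT: "A \<subseteq> T" and B: "disjoint B" "B \<subseteq> C"
    and two: "\<And>b. b \<in> E \<Longrightarrow> card (nbrs A b) \<le> 2" and "E \<subseteq> B"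
  shows "token_search (nbrs A) E l X F \<Longrightarrow> inj_on h (\<Union>X) \<Longrightarrow> (F, h ` \<Union>X) \<in> reach T h A C l"
proof (induction rule: token_search.induct)
  case (start e e')
  have "e \<inter> e' = {}" using start B \<open>E \<subseteq> B\<close> by (auto simp: disjoint_def)
  then have "h ` e \<inter> h ` e' = {}" using start by (auto dest: inj_onD)
  moreover have "card (nbrs A e \<union> nbrs A e') \<le> 4"
    using card_Un_le[of "nbrs A e" "nbrs A e'"] two[OF start(1)] two[OF start(2)] by linarith
  then have "nbrs A e \<union> nbrs A e' \<in> fronts T"
    using AT nbrs_subset[of A e] nbrs_subset[of A e'] by (auto simp: fronts_def)
  moreover have "h ` \<Union>{e, e'} = h ` e \<union> h ` e'" by auto
  moreover have "e \<in> C" "e' \<in> C" using start B \<open>E \<subseteq> B\<close> by auto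
  moreover have "nbrs A e \<subseteq> nbrs A e \<union> nbrs A e'" "nbrs A e' \<subseteq> nbrs A e \<union> nbrs A e'" by auto
  ultimately show ?case unfolding reach.simps mem_Collect_eq by metis
next
  case (move l X F b v u)
  have X: "X \<subseteq> B" using token_search_props[OF move.hyps(1)] \<open>E \<subseteq> B\<close> by auto
  have b: "b \<in> B" using move.hyps(2) \<open>E \<subseteq> B\<close> by auto
  have "b \<inter> S = {}" if "S \<in> X" for S
    using that move.hyps(3) X b B(1) unfolding disjoint_def by (metis subsetD)
  then have d: "b \<inter> \<Union>X = {}" by auto
  have inj: "inj_on h (b \<union> \<Union>X)" using move.prems by simp
  have "h ` b \<inter> h ` \<Union>X = {}" using inj_on_image_Int[OF inj, of b "\<Union>X"] d by auto
  moreover have "(F, h ` \<Union>X) \<in> reach T h A C l" using move.IH inj inj_on_subset by blast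
  moreover have "u \<in> T" using move.hyps(5) nbrs_subset[of A b] AT by auto
  moreover have "h ` \<Union>(insert b X) = h ` \<Union>X \<union> h ` b" by auto
  moreover have "b \<in> C" using b B(2) by auto
  moreover have "nbrs A b \<subseteq> {u, v}" using move.hyps(5) by auto
  ultimately show ?case unfolding reach.simps mem_Collect_eq using move.hyps(4) by metis
qed

text \<open>Choosing a common point of \<open>a\<close> and \<open>b\<close> for each such
  \<open>b\<close> is injective by disjointness.\<close>

lemma card_hit_le:
  assumes "disjoint B" and "finite a"
  shows "card {b \<in> B. a \<inter> b \<noteq> {}} \<le> card a"
proof -
  have "\<forall>b\<in>{b \<in> B. a \<inter> b \<noteq> {}}. \<exists>x. x \<in> a \<inter> b" by auto
  then obtain f where f: "\<And>b. b \<in> {b \<in> B. a \<inter> b \<noteq> {}} \<Longrightarrow> f b \<in> a \<inter> b" by metis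
  have "inj_on f {b \<in> B. a \<inter> b \<noteq> {}}"
  proof (rule inj_onI)
    fix b b' assume *: "b \<in> {b \<in> B. a \<inter> b \<noteq> {}}" "b' \<in> {b \<in> B. a \<inter> b \<noteq> {}}" "f b = f b'"
    then have "f b \<in> b \<inter> b'" using f[OF *(1)] f[OF *(2)] by auto
    then show "b = b'" using * assms(1) by (auto simp: disjoint_def)
  qed
  then show ?thesis using f assms(2) by (intro card_inj_on_le) auto
qed

text \<open>A set with \<open>t \<ge> 1\<close> neighbours satisfies
  \<open>3 \<le> t + [t = 1] + [t \<le> 2]\<close>. Summing over \<open>B\<close> gives at most
  \<open>k * card A + card A + 2 * card A\<close>.\<close>

lemma local_optimum_bound:
  assumes k: "k > 0" and card_k: "\<And>S. S \<in> T \<Longrightarrow> S \<subseteq> U \<and> card S = k" and U: "finite U"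
    and hash: "\<And>Y. Y \<subseteq> U \<Longrightarrow> card Y \<le> k * (4 * d + 2) \<Longrightarrow> \<exists>h\<in>H. inj_on h Y"
    and A: "A \<subseteq> T" "card A < 2 ^ d"
    and C: "C \<subseteq> T" and B: "B \<subseteq> C" "disjoint B"
    and opt: "\<not> improvable T H (4 * d) A C"
  shows "3 * card B \<le> (k + 3) * card A"
proof -
  have T: "finite T" using card_k U by (intro finite_subset[of T "Pow U"]) auto
  have fA: "finite A" and fB: "finite B" using T A B C by (auto intro: finite_subset)
  have fin: "finite S" if "S \<in> T" for S using card_k[OF that] U finite_subset by auto
  let ?N = "nbrs A"
  have fN: "finite (?N b)" for b using fA nbrs_subset finite_subset by metis
  have none: "?N b \<noteq> {}" if "b \<in> B" for b using opt that B unfolding improvable_def by auto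
  \<comment> \<open>A search ending in at most one token uses at most \<open>4 * d + 2\<close> sets,
    hence few enough elements for some colouring in \<open>H\<close> to separate; that colouring
    would make \<open>C\<close> improvable.\<close>
  have no_search: False if s: "token_search ?N E l X F" and l: "l \<le> 4 * d" "card F \<le> 1"
    and E: "E \<subseteq> B" "\<And>b. b \<in> E \<Longrightarrow> card (?N b) \<le> 2" for E l X F
  proof -
    note X = token_search_props[OF s]
    have XT: "X \<subseteq> T" using X E(1) B(1) C by blast
    have "card (\<Union>X) \<le> (\<Sum>S\<in>X. card S)" using X by (intro card_Union_le_sum_card)
    also have "\<dots> = (\<Sum>S\<in>X. k)" using card_k XT by (intro sum.cong) auto
    also have "\<dots> = k * (l + 2)" using X by simp
    also have "\<dots> \<le> k * (4 * d + 2)" using l by (intro mult_le_mono2) auto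
    finally obtain h where h: "h \<in> H" "inj_on h (\<Union>X)" using hash[of "\<Union>X"] XT card_k by blast
    have "(F, h ` \<Union>X) \<in> reach T h A C l"
      by (rule reach_complete[OF A(1) B(2,1) E(2,1) s h(2)])
    then show False using opt h l unfolding improvable_def by blast
  qed
  define B1 where "B1 = {b \<in> B. card (?N b) = 1}"
  define B2 where "B2 = {b \<in> B. card (?N b) \<le> 2}"
  have "card B2 \<le> 2 * card A"
  proof (rule ccontr)
    assume "\<not> ?thesis"
    then have big: "2 * card A < card B2" by simp
    have B2: "B2 \<subseteq> B" "\<And>b. b \<in> B2 \<Longrightarrow> card (?N b) \<le> 2" by (auto simp: B2_def)
    have "\<exists>l X F. token_search ?N B2 l X F \<and> card F \<le> 1 \<and> l \<le> 4 * d"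
    proof (rule token_search_complete[OF fA _ _ _ _ big A(2)])
      show "finite B2" using B2 fB finite_subset by metis
    qed (use B2 none nbrs_subset in blast)+
    then obtain l X F where "token_search ?N B2 l X F" "l \<le> 4 * d" "card F \<le> 1" by blast
    then show False using no_search[OF _ _ _ B2] by blast
  qed
  moreover have "card B1 \<le> card A"
  proof -
    \<comment> \<open>Two sets with the same single neighbour form a start state with only one
      token.\<close>
    have "inj_on ?N B1"
    proof (rule inj_onI, rule ccontr)
      fix b b' assume b: "b \<in> B1" "b' \<in> B1" "?N b = ?N b'" "b \<noteq> b'"
      have B1: "B1 \<subseteq> B" "\<And>b. b \<in> B1 \<Longrightarrow> card (?N b) \<le> 2" by (auto simp: B1_def)
      have "card (?N b \<union> ?N b') \<le> 1" using b by (simp add: B1_def)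
      then show False using no_search[OF token_search.start[OF b(1,2,4)] _ _ B1] by blast
    qed
    moreover have "?N ` B1 \<subseteq> (\<lambda>a. {a}) ` A"
      using nbrs_subset[of A] by (fastforce simp: B1_def card_1_singleton_iff)
    ultimately have "card B1 \<le> card ((\<lambda>a. {a}) ` A)" using fA by (metis card_image card_mono finite_imageI)
    then show ?thesis using card_image_le[OF fA, of "\<lambda>a. {a}"] by simp
  qed
  moreover have "(\<Sum>b\<in>B. card (?N b)) \<le> k * card A"
  proof -
    have "(\<Sum>b\<in>B. card (?N b)) = (\<Sum>a\<in>A. card {b \<in> B. a \<inter> b \<noteq> {}})"
      unfolding nbrs_def using sum_multicount_gen[OF fB fA, of "\<lambda>b a. a \<inter> b \<noteq> {}" "\<lambda>a. card {b \<in> B. a \<inter> b \<noteq> {}}"]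
      by simp
    also have "\<dots> \<le> (\<Sum>a\<in>A. k)"
    proof (rule sum_mono)
      fix a assume "a \<in> A"
      then have "finite a" "card a = k" using fin card_k A by auto
      then show "card {b \<in> B. a \<inter> b \<noteq> {}} \<le> k" using card_hit_le[OF B(2), of a] by simp
    qed
    finally show ?thesis by (simp add: mult.commute)
  qed
  moreover have "3 * card B \<le> (\<Sum>b\<in>B. card (?N b)) + card B1 + card B2"
  proof -
    have "3 * card B = (\<Sum>b\<in>B. 3)" by simp
    also have "\<dots> \<le> (\<Sum>b\<in>B. card (?N b) + of_bool (card (?N b) = 1) + of_bool (card (?N b) \<le> 2))"
    proof (rule sum_mono)
      fix b assume "b \<in> B"
      then have "card (?N b) > 0" using none fN by (simp add: card_gt_0_iff)
      then show "3 \<le> card (?N b) + of_bool (card (?N b) = 1) + of_bool (card (?N b) \<le> 2)"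
        by (auto simp: of_bool_def)
    qed
    also have "\<dots> = (\<Sum>b\<in>B. card (?N b)) + card B1 + card B2"
      using fB by (simp add: sum.distrib B1_def B2_def sum.If_cases of_bool_def Int_def)
    finally show ?thesis .
  qed
  ultimately show ?thesis by (simp add: algebra_simps)
qed

section \<open>Local search\<close>

text \<open>A circuit cannot choose an improving family, but it can test improvability; deleting
  members in a fixed order as long as the test succeeds extracts one.\<close>

fun prune :: "('a set \<Rightarrow> bool) \<Rightarrow> 'a list \<Rightarrow> 'a set \<Rightarrow> 'a set" where
  "prune good [] C = C"
| "prune good (S # Ss) C = prune good Ss (if good (C - {S}) then C - {S} else C)"

lemma prune_subset: "prune good Ss C \<subseteq> C"
proof (induction Ss arbitrary: C)
  case (Cons S Ss)
  then show ?case using Cons.IH[of "C - {S}"] Cons.IH[of C] by (simp, blast)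
qed simp

lemma prune_good: "good C \<Longrightarrow> good (prune good Ss C)"
  by (induction Ss arbitrary: C) auto

text \<open>A refused deletion stays refused: the family only shrinks afterwards, and
  \<open>good\<close> is monotone.\<close>

lemma prune_minimal:
  assumes mono: "\<And>C C'. good C \<Longrightarrow> C \<subseteq> C' \<Longrightarrow> good C'"
  shows "S \<in> set Ss \<Longrightarrow> S \<in> prune good Ss C \<Longrightarrow> \<not> good (prune good Ss C - {S})"
proof (induction Ss arbitrary: C)
  case (Cons S' Ss)
  let ?C = "if good (C - {S'}) then C - {S'} else C"
  show ?case
  proof (cases "S \<in> set Ss")
    case True
    then show ?thesis using Cons.IH[of ?C] Cons.prems by simp
  next
    case False
    then have S: "S = S'" using Cons.prems by simp
    have "S \<in> ?C" using Cons.prems(2) prune_subset[of good Ss ?C] by auto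
    then have "\<not> good (C - {S})" using S by (auto split: if_splits)
    moreover have "prune good (S' # Ss) C - {S} \<subseteq> C - {S}" using prune_subset[of good "S' # Ss" C] by blast
    ultimately show ?thesis using mono by blast
  qed
qed simp

definition exchange :: "'a set set \<Rightarrow> 'a set set \<Rightarrow> 'a set set" where
  "exchange X A = X \<union> {a \<in> A. \<forall>b\<in>X. a \<inter> b = {}}"

lemma exchange_empty [simp]: "exchange {} A = A" by (simp add: exchange_def)

lemma card_exchange:
  assumes "finite A" and "finite X" and "\<And>b. b \<in> X \<Longrightarrow> b \<noteq> {}"
  shows "card (exchange X A) + card (\<Union>b\<in>X. nbrs A b) = card X + card A"
proof -
  let ?R = "{a \<in> A. \<forall>b\<in>X. a \<inter> b = {}}" and ?N = "\<Union>b\<in>X. nbrs A b"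
  have A: "A = ?R \<union> ?N" "?R \<inter> ?N = {}" by (auto simp: nbrs_def)
  have fin: "finite ?R" "finite ?N" using assms by (auto simp: nbrs_def)
  \<comment> \<open>A common member would be disjoint from itself, hence empty.\<close>
  have "X \<inter> ?R = {}" using assms(3) by auto
  then have "card (exchange X A) = card X + card ?R"
    unfolding exchange_def using assms(2) fin(1) by (intro card_Un_disjoint) auto
  moreover have "card A = card ?R + card ?N"
    using card_Un_disjoint[OF fin A(2)] A(1) by simp
  ultimately show ?thesis by simp
qed

definition local_step :: "nat set set \<Rightarrow> (nat \<Rightarrow> nat) set \<Rightarrow> nat \<Rightarrow> nat set list
    \<Rightarrow> nat set set \<Rightarrow> nat set set \<Rightarrow> nat set set" where
  "local_step T H L Ss A C =
     exchange (if improvable T H L A C then prune (improvable T H L A) Ss C else {}) A"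

text \<open>An inclusion-minimal improvable family is itself an improving family of disjoint sets.\<close>

lemma local_step_improves:
  assumes T: "finite T" "set Ss = T" and C: "C \<subseteq> T" and ne: "\<And>S. S \<in> T \<Longrightarrow> S \<noteq> {}"
    and A: "A \<subseteq> C" "disjoint A"
  shows "local_step T H L Ss A C \<subseteq> C" and "disjoint (local_step T H L Ss A C)"
    and "improvable T H L A C \<Longrightarrow> card A < card (local_step T H L Ss A C)"
    and "\<not> improvable T H L A C \<Longrightarrow> local_step T H L Ss A C = A"
proof -
  let ?good = "improvable T H L A"
  define X where "X = prune ?good Ss C"
  have X: "finite X \<and> disjoint X \<and> card (\<Union>b\<in>X. nbrs A b) < card X \<and> X \<subseteq> C" if i: "?good C"
  proof -
    have XC: "X \<subseteq> C" unfolding X_def by (rule prune_subset)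
    have "?good X" unfolding X_def using i by (rule prune_good[where good = ?good])
    moreover have ne': "\<And>S. S \<in> X \<Longrightarrow> S \<noteq> {}" using XC C ne by blast
    ultimately obtain Y where Y: "Y \<subseteq> X" "finite Y" "disjoint Y" "card (\<Union>b\<in>Y. nbrs A b) < card Y" "?good Y"
      using improvable_sound[OF T(1)] by metis
    \<comment> \<open>\<open>Y\<close> is improvable by itself, so a member of \<open>X\<close>
      outside \<open>Y\<close> would have been pruned.\<close>
    have "Y = X"
    proof (rule ccontr)
      assume "Y \<noteq> X"
      then obtain S where S: "S \<in> X" "S \<notin> Y" using Y(1) by blast
      then have "S \<in> set Ss" using XC C T by blast
      then have "\<not> ?good (X - {S})"
        using prune_minimal[of ?good S Ss C] improvable_mono S(1) unfolding X_def by blast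
      moreover have "Y \<subseteq> X - {S}" using Y(1) S(2) by blast
      ultimately show False using improvable_mono[OF Y(5)] by blast
    qed
    then show ?thesis using Y XC by blast
  qed
  have fA: "finite A" using A C T finite_subset by metis
  show n: "local_step T H L Ss A C = A" if "\<not> ?good C" using that by (simp add: local_step_def)
  have e: "local_step T H L Ss A C = exchange X A" if "?good C" using that by (simp add: local_step_def X_def)
  show "local_step T H L Ss A C \<subseteq> C"
    using n e X A(1) by (cases "?good C") (auto simp: exchange_def)
  show "disjoint (local_step T H L Ss A C)"
  proof (cases "?good C")
    case True
    show ?thesis unfolding e[OF True]
    proof (rule disjointI)
      fix a b assume ab: "a \<in> exchange X A" "b \<in> exchange X A" "a \<noteq> b"
      have "disjoint X" using X True by blast
      then have "a \<inter> b = {}" if "a \<in> X" "b \<in> X" using disjointD that ab(3) by metis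
      moreover have "a \<inter> b = {}" if "a \<in> A" "b \<in> A" using disjointD[OF A(2)] that ab(3) by metis
      ultimately show "a \<inter> b = {}" using ab(1,2) by (auto simp: exchange_def)
    qed
  qed (simp add: n A)
  show "card A < card (local_step T H L Ss A C)" if g: "?good C"
  proof -
    have "\<And>b. b \<in> X \<Longrightarrow> b \<noteq> {}" using X[OF g] C ne by blast
    then show ?thesis using card_exchange[OF fA, of X] X[OF g] e[OF g] by simp
  qed
qed

fun local_search :: "nat set set \<Rightarrow> (nat \<Rightarrow> nat) set \<Rightarrow> nat \<Rightarrow> nat set list \<Rightarrow> nat set set
    \<Rightarrow> nat \<Rightarrow> nat set set" where
  "local_search T H L Ss C 0 = {}"
| "local_search T H L Ss C (Suc i) = local_step T H L Ss (local_search T H L Ss C i) C"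

text \<open>As long as an improvement exists, every round gains at least one set, and once there is
  none the packing stays fixed. A packing inside \<open>C\<close> cannot reach size
  \<open>card C + 1\<close>, so that many rounds suffice.\<close>

lemma local_search_optimal:
  fixes H :: "(nat \<Rightarrow> nat) set" and L :: nat
  assumes T: "finite T" "set Ss = T" and C: "C \<subseteq> T" and ne: "\<And>S. S \<in> T \<Longrightarrow> S \<noteq> {}"
  defines "A \<equiv> local_search T H L Ss C"
  shows "A i \<subseteq> C \<and> disjoint (A i)" and "\<not> improvable T H L (A (card C + 1)) C"
proof -
  have p: "A i \<subseteq> C \<and> disjoint (A i)" for i
  proof (induction i)
    case (Suc i)
    then show ?case unfolding A_def using local_step_improves(1,2)[OF T C ne] by simp
  qed (simp add: A_def)
  then show "A i \<subseteq> C \<and> disjoint (A i)" .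
  have "\<not> improvable T H L (A i) C \<or> i \<le> card (A i)" for i
  proof (induction i)
    case (Suc i)
    have s: "A (Suc i) = local_step T H L Ss (A i) C" by (simp add: A_def)
    have pi: "A i \<subseteq> C" "disjoint (A i)" using p by auto
    show ?case
    proof (cases "improvable T H L (A i) C")
      case True
      then show ?thesis using Suc local_step_improves(3)[OF T C ne pi, of H L] unfolding s by simp
    next
      case False
      then show ?thesis using local_step_improves(4)[OF T C ne pi, of H L] unfolding s by simp
    qed
  qed simp
  moreover have "card (A (card C + 1)) \<le> card C"
    using p C T by (meson card_mono finite_subset)
  ultimately show "\<not> improvable T H L (A (card C + 1)) C" by (metis add.commute not_less_eq_eq plus_1_eq_Suc)
qed

section \<open>Circuits for the local search\<close>

lemma computes_dnf':
  assumes "finite F" and "finite I" and "card F \<le> m" and "card I \<le> n"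
    and PQ: "\<And>i. i \<in> I \<Longrightarrow> P i \<subseteq> F \<and> Q i \<subseteq> F"
    and g: "\<And>C. g C \<longleftrightarrow> (\<exists>i\<in>I. (\<forall>f\<in>P i. f C) \<and> (\<forall>f\<in>Q i. \<not> f C))"
  shows "computes (m + n + 2) F {g}"
proof -
  have eq: "g = (\<lambda>C. \<exists>i\<in>I. (\<forall>f\<in>P i. f C) \<and> (\<forall>f\<in>Q i. \<not> f C))" using g by (rule ext)
  have "computes (card F + card I + 2) F {\<lambda>C. \<exists>i\<in>I. (\<forall>f\<in>P i. f C) \<and> (\<forall>f\<in>Q i. \<not> f C)}"
    by (rule computes_dnf[where P = P and Q = Q, OF assms(1,2) PQ])
  then have c: "computes (card F + card I + 2) F {g}" by (subst eq)
  have "card F + card I + 2 \<le> m + n + 2" using assms(3,4) by simp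
  then show ?thesis by (rule computes_mono[OF c order_refl order_refl])
qed

lemma computes_or':
  assumes "F' \<subseteq> F" and g: "\<And>C. g C \<longleftrightarrow> (\<exists>f\<in>F'. f C)"
  shows "computes 2 F {g}"
proof -
  have eq: "g = (\<lambda>C. \<exists>f\<in>F'. f C)" using g by (rule ext)
  show ?thesis by (subst eq) (rule computes_or[OF assms(1)])
qed

text \<open>A family that depends on the instance, such as the current packing, is carried by the
  circuit as one bit for each candidate set in \<open>T\<close>.\<close>

definition member_pred :: "(nat set set \<Rightarrow> nat set set) \<Rightarrow> nat set \<Rightarrow> instance_pred" where
  "member_pred A S = (\<lambda>C. S \<in> A C)"

definition member_preds :: "nat set set \<Rightarrow> (nat set set \<Rightarrow> nat set set) \<Rightarrow> instance_pred set" where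
  "member_preds T A = member_pred A ` T"

lemma member_pred_iff: "member_pred A S C \<longleftrightarrow> S \<in> A C" by (simp add: member_pred_def)

lemma member_pred_in_member_preds: "S \<in> T \<Longrightarrow> member_pred A S \<in> member_preds T A" by (simp add: member_preds_def)

lemma finite_member_preds: "finite T \<Longrightarrow> finite (member_preds T A)" by (simp add: member_preds_def)

lemma card_member_preds_le: "finite T \<Longrightarrow> card (member_preds T A) \<le> card T" by (simp add: member_preds_def card_image_le)

lemma computes_member_preds:
  assumes "finite T" and "\<And>S. S \<in> T \<Longrightarrow> computes c F {member_pred A S}"
  shows "computes (card T * c) F (member_preds T A)"
  unfolding member_preds_def by (rule computes_image[OF assms])

text \<open>Apart from the recursive call, the families \<open>A\<close> and \<open>Q\<close> enter
  the conditions of \<open>reach\<close> and \<open>improvable\<close> only through such tests, with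
  \<open>W\<close> among the fronts.\<close>

definition probe :: "(nat set set \<Rightarrow> nat set set) \<Rightarrow> (nat set set \<Rightarrow> nat set set) \<Rightarrow>
    nat set \<Rightarrow> nat set set \<Rightarrow> instance_pred" where
  "probe A Q b W = (\<lambda>C. b \<in> Q C \<and> nbrs (A C) b \<subseteq> W)"

definition probes :: "nat set set \<Rightarrow> (nat set set \<Rightarrow> nat set set) \<Rightarrow> (nat set set \<Rightarrow> nat set set)
    \<Rightarrow> instance_pred set" where
  "probes T A Q = (\<lambda>(b, W). probe A Q b W) ` (T \<times> fronts T)"

lemma probe_in_probes: "b \<in> T \<Longrightarrow> W \<in> fronts T \<Longrightarrow> probe A Q b W \<in> probes T A Q"
  unfolding probes_def by (rule image_eqI[of _ _ "(b, W)"]) auto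

lemma finite_fronts: "finite T \<Longrightarrow> finite (fronts T)"
  unfolding fronts_def by (rule finite_subset[of _ "Pow T"]) auto

lemma card_probes_le: "finite T \<Longrightarrow> card (probes T A Q) \<le> card T * card (fronts T)"
  unfolding probes_def by (metis card_cartesian_product card_image_le finite_SigmaI finite_fronts)

lemma finite_probes: "finite T \<Longrightarrow> finite (probes T A Q)"
  unfolding probes_def by (simp add: finite_fronts)

lemma computes_probes:
  assumes T: "finite T" and A: "\<And>C. A C \<subseteq> T"
  shows "computes (card T * card (fronts T) * (2 * card T + 3)) (member_preds T A \<union> member_preds T Q) (probes T A Q)"
proof -
  have "computes (card (T \<times> fronts T) * (2 * card T + 3)) (member_preds T A \<union> member_preds T Q) (probes T A Q)"
    unfolding probes_def
  proof (rule computes_image)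
    show "finite (T \<times> fronts T)" using T finite_fronts by blast
    fix x assume "x \<in> T \<times> fronts T"
    then obtain b W where x: "x = (b, W)" "b \<in> T" by auto
    have "computes (2 * card T + 1 + 2) (member_preds T A \<union> member_preds T Q) {probe A Q b W}"
    \<comment> \<open>A single term: \<open>b\<close> is available, and every set outside
      \<open>W\<close> that meets \<open>b\<close> is absent from the packing.\<close>
    proof (rule computes_dnf'[where I = "{()}" and P = "\<lambda>_. {member_pred Q b}" and
          Q = "\<lambda>_. member_pred A ` {a \<in> T - W. a \<inter> b \<noteq> {}}"])
      show "card (member_preds T A \<union> member_preds T Q) \<le> 2 * card T"
        using card_Un_le[of "member_preds T A" "member_preds T Q"] card_member_preds_le[OF T, of A] card_member_preds_le[OF T, of Q] by simp
      show "finite (member_preds T A \<union> member_preds T Q)" using T finite_member_preds by blast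
      show "{member_pred Q b} \<subseteq> member_preds T A \<union> member_preds T Q \<and> member_pred A ` {a \<in> T - W. a \<inter> b \<noteq> {}} \<subseteq> member_preds T A \<union> member_preds T Q"
        using x by (auto simp: member_preds_def)
      fix C
      show "probe A Q b W C \<longleftrightarrow> (\<exists>i\<in>{()}. (\<forall>f\<in>{member_pred Q b}. f C) \<and>
          (\<forall>f\<in>member_pred A ` {a \<in> T - W. a \<inter> b \<noteq> {}}. \<not> f C))"
        using A[of C] by (auto simp: probe_def member_pred_iff nbrs_def)
    qed auto
    then show "computes (2 * card T + 3) (member_preds T A \<union> member_preds T Q) {case x of (b, W) \<Rightarrow> probe A Q b W}"
      using x by (simp add: numeral_3_eq_3)
  qed
  then show ?thesis by (simp add: card_cartesian_product)
qed

text \<open>There are \<open>card (fronts T) * 2 ^ c\<close> of them, which is polynomial when the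
  number \<open>c\<close> of colours is logarithmic.\<close>

definition states :: "nat set set \<Rightarrow> nat \<Rightarrow> (nat set set \<times> nat set) set" where
  "states T c = fronts T \<times> Pow {..<c}"

definition reach_bit :: "nat set set \<Rightarrow> (nat set set \<Rightarrow> nat set set) \<Rightarrow> (nat set set \<Rightarrow> nat set set) \<Rightarrow>
    (nat \<Rightarrow> nat) \<Rightarrow> nat \<Rightarrow> nat set set \<times> nat set \<Rightarrow> instance_pred" where
  "reach_bit T A Q h l x = (\<lambda>C. x \<in> reach T h (A C) (Q C) l)"

definition reach_bits :: "nat set set \<Rightarrow> nat \<Rightarrow> (nat set set \<Rightarrow> nat set set) \<Rightarrow> (nat set set \<Rightarrow> nat set set) \<Rightarrow>
    (nat \<Rightarrow> nat) \<Rightarrow> nat \<Rightarrow> instance_pred set" where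
  "reach_bits T c A Q h l = reach_bit T A Q h l ` states T c"

lemma finite_states: "finite T \<Longrightarrow> finite (states T c)"
  by (simp add: states_def finite_fronts)

lemma doubleton_fronts: "u \<in> T \<Longrightarrow> v \<in> T \<Longrightarrow> {u, v} \<in> fronts T"
  by (auto simp: fronts_def card_insert_if)

lemma image_Union_subset:
  assumes "\<And>S. S \<in> T \<Longrightarrow> h ` S \<subseteq> B" and "Q \<subseteq> T" shows "h ` \<Union>Q \<subseteq> B"
proof (rule image_subsetI)
  fix v assume "v \<in> \<Union>Q"
  then obtain S where "S \<in> Q" "v \<in> S" by (rule UnionE)
  then show "h v \<in> B" using assms imageI[of v S h] by (meson subsetD)
qed

text \<open>One bound for a bit of any layer: the inputs, namely probes and bits of the previous
  layer; the terms, namely pairs of starting sets or a previous state with three sets; and two gates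
  for the disjunction.\<close>

definition reach_cost :: "nat set set \<Rightarrow> nat \<Rightarrow> nat" where
  "reach_cost T c = card T * card (fronts T) + card (states T c) +
     (card T ^ 2 + card (states T c) * card T ^ 3) + 2"

lemma computes_reach_0:
  assumes T: "finite T" and Q: "\<And>C. Q C \<subseteq> T" and x: "x \<in> states T c"
  shows "computes (reach_cost T c) (probes T A Q) {reach_bit T A Q h 0 x}"
proof -
  obtain F D where FD: "x = (F, D)" "F \<in> fronts T" using x by (auto simp: states_def)
  \<comment> \<open>The colour conditions do not involve the instance. They select the terms when
    the circuit is built; what remains of each term is two probes.\<close>
  define I where "I = {(e, e') \<in> T \<times> T. h ` e \<inter> h ` e' = {} \<and> D = h ` e \<union> h ` e'}"
  have I: "I \<subseteq> T \<times> T" by (auto simp: I_def)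
  have "computes (card T * card (fronts T) + card T ^ 2 + 2) (probes T A Q) {reach_bit T A Q h 0 x}"
  proof (rule computes_dnf'[where I = I and P = "\<lambda>(e, e'). {probe A Q e F, probe A Q e' F}" and Q = "\<lambda>_. {}"])
    show "finite I" using I T by (meson finite_SigmaI finite_subset)
    have "card I \<le> card (T \<times> T)" using I T by (intro card_mono) auto
    then show "card I \<le> card T ^ 2" by (simp add: card_cartesian_product power2_eq_square)
    show "(case i of (e, e') \<Rightarrow> {probe A Q e F, probe A Q e' F}) \<subseteq> probes T A Q \<and> {} \<subseteq> probes T A Q"
      if "i \<in> I" for i
      using that I FD(2) probe_in_probes[of _ T F A Q] by auto
    fix C
    have "reach_bit T A Q h 0 x C \<longleftrightarrow> (\<exists>e e'. (e, e') \<in> I \<and> probe A Q e F C \<and> probe A Q e' F C)"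
      unfolding reach_bit_def FD(1) I_def probe_def using FD(2) Q[of C] by auto
    then show "reach_bit T A Q h 0 x C \<longleftrightarrow> (\<exists>i\<in>I. (\<forall>f\<in>case i of (e, e') \<Rightarrow> {probe A Q e F, probe A Q e' F}. f C) \<and>
        (\<forall>f\<in>{}. \<not> f C))" by auto
  qed (use T finite_probes card_probes_le in auto)
  then show ?thesis by (rule computes_mono) (auto simp: reach_cost_def)
qed

text \<open>A dynamic program: one term for each transition into \<open>x\<close>, consisting of the
  bit of the previous state and one probe for the set \<open>b\<close>.\<close>

lemma computes_reach_Suc:
  assumes T: "finite T" and Q: "\<And>C. Q C \<subseteq> T" and h: "\<And>S. S \<in> T \<Longrightarrow> h ` S \<subseteq> {..<c}" and x: "x \<in> states T c"
  shows "computes (reach_cost T c) (probes T A Q \<union> reach_bits T c A Q h l) {reach_bit T A Q h (Suc l) x}"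
proof -
  let ?F = "probes T A Q \<union> reach_bits T c A Q h l"
  define I where "I = {((F, D), b, u, v) | F D b u v. (F, D) \<in> states T c \<and> b \<in> T \<and> u \<in> T \<and> v \<in> F \<and>
    h ` b \<inter> D = {} \<and> x = (insert u (F - {v}), D \<union> h ` b)}"
  define P where "P = (\<lambda>(y, b, u, v). {reach_bit T A Q h l y, probe A Q b {u, v}})"
  have I: "I \<subseteq> states T c \<times> T \<times> T \<times> T" by (auto simp: I_def states_def fronts_def)
  have "computes ((card T * card (fronts T) + card (states T c)) + card (states T c) * card T ^ 3 + 2) ?F
    {reach_bit T A Q h (Suc l) x}"
  proof (rule computes_dnf'[where I = I and P = P and Q = "\<lambda>_. {}"])
    have fin: "finite (states T c \<times> T \<times> T \<times> T)" using T finite_states by auto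
    then show "finite I" using I finite_subset by blast
    have "card I \<le> card (states T c \<times> T \<times> T \<times> T)" using I fin by (intro card_mono)
    then show "card I \<le> card (states T c) * card T ^ 3" by (simp add: card_cartesian_product eval_nat_numeral)
    show "finite ?F" using T finite_probes finite_states by (auto simp: reach_bits_def)
    have "card (reach_bits T c A Q h l) \<le> card (states T c)"
      unfolding reach_bits_def using T finite_states by (intro card_image_le) auto
    then show "card ?F \<le> card T * card (fronts T) + card (states T c)"
      using card_Un_le[of "probes T A Q" "reach_bits T c A Q h l"] card_probes_le[OF T, of A Q] by linarith
    show "P i \<subseteq> ?F \<and> {} \<subseteq> ?F" if i: "i \<in> I" for i
    proof -
      obtain y b u v where iy: "i = (y, b, u, v)" by (cases i)
      moreover have "i \<in> states T c \<times> T \<times> T \<times> T" using i I by (rule subsetD[rotated])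
      ultimately have y: "i = (y, b, u, v)" "y \<in> states T c" "b \<in> T" "u \<in> T" "v \<in> T" by simp_all
      then have "probe A Q b {u, v} \<in> probes T A Q" by (intro probe_in_probes doubleton_fronts)
      moreover have "reach_bit T A Q h l y \<in> reach_bits T c A Q h l" using y by (simp add: reach_bits_def)
      ultimately show ?thesis using y by (simp add: P_def)
    qed
    fix C
    \<comment> \<open>No reachable predecessor is missed by the enumeration of states.\<close>
    have st: "(F, D) \<in> states T c" if r: "(F, D) \<in> reach T h (A C) (Q C) l" for F D
    proof -
      have "F \<in> fronts T" using reach_fronts[OF T r] .
      moreover have "D \<subseteq> {..<c}"
      proof -
        have "h ` \<Union>(Q C) \<subseteq> {..<c}" using h Q by (rule image_Union_subset)
        then show ?thesis using reach_colours[OF r] by simp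
      qed
      ultimately show ?thesis by (simp add: states_def)
    qed
    show "reach_bit T A Q h (Suc l) x C \<longleftrightarrow> (\<exists>i\<in>I. (\<forall>f\<in>P i. f C) \<and> (\<forall>f\<in>{}. \<not> f C))"
    proof
      assume "reach_bit T A Q h (Suc l) x C"
      then obtain F D b u v where r: "x = (insert u (F - {v}), D \<union> h ` b)" "(F, D) \<in> reach T h (A C) (Q C) l"
        "b \<in> Q C" "u \<in> T" "v \<in> F" "h ` b \<inter> D = {}" "nbrs (A C) b \<subseteq> {u, v}"
        by (auto simp: reach_bit_def)
      then have "((F, D), b, u, v) \<in> I" using st Q[of C] by (auto simp: I_def)
      moreover have "\<forall>f\<in>P ((F, D), b, u, v). f C" using r by (simp add: P_def reach_bit_def probe_def)
      ultimately show "\<exists>i\<in>I. (\<forall>f\<in>P i. f C) \<and> (\<forall>f\<in>{}. \<not> f C)"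
        by (intro bexI[of _ "((F, D), b, u, v)"] conjI) simp_all
    next
      assume "\<exists>i\<in>I. (\<forall>f\<in>P i. f C) \<and> (\<forall>f\<in>{}. \<not> f C)"
      then obtain i where i: "i \<in> I" "\<forall>f\<in>P i. f C" by blast
      then obtain F D b u v where r: "i = ((F, D), b, u, v)" "u \<in> T" "v \<in> F"
        "h ` b \<inter> D = {}" "x = (insert u (F - {v}), D \<union> h ` b)" unfolding I_def by blast
      have "(F, D) \<in> reach T h (A C) (Q C) l" "b \<in> Q C" "nbrs (A C) b \<subseteq> {u, v}"
        using i(2) unfolding r(1) by (simp_all add: P_def reach_bit_def probe_def)
      then show "reach_bit T A Q h (Suc l) x C"
        unfolding reach_bit_def reach.simps mem_Collect_eq using r by blast
    qed
  qed
  then show ?thesis by (rule computes_mono) (auto simp: reach_cost_def)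
qed

lemma computes_reach:
  assumes T: "finite T" and Q: "\<And>C. Q C \<subseteq> T" and h: "\<And>S. S \<in> T \<Longrightarrow> h ` S \<subseteq> {..<c}"
  shows "computes ((L + 1) * (card (states T c) * reach_cost T c)) (probes T A Q) (\<Union>l\<le>L. reach_bits T c A Q h l)"
proof (induction L)
  case 0
  have "computes (card (states T c) * reach_cost T c) (probes T A Q) (reach_bits T c A Q h 0)"
    unfolding reach_bits_def by (intro computes_image computes_reach_0 T Q finite_states)
  then show ?case by simp
next
  case (Suc L)
  have "computes (card (states T c) * reach_cost T c) (probes T A Q \<union> reach_bits T c A Q h L) (reach_bits T c A Q h (Suc L))"
    unfolding reach_bits_def[of T c A Q h "Suc L"]
    by (intro computes_image computes_reach_Suc T Q h finite_states)
  then have "computes (card (states T c) * reach_cost T c) (probes T A Q \<union> (\<Union>l\<le>L. reach_bits T c A Q h l))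
      (reach_bits T c A Q h (Suc L))" by (rule computes_mono) auto
  from computes_trans[OF Suc.IH this]
  show ?case by (rule computes_mono) (auto simp: atMost_Suc)
qed

text \<open>\<open>m\<close> is the number of colourings. The probes are paid once, as all
  colourings share them.\<close>

definition test_cost :: "nat set set \<Rightarrow> nat \<Rightarrow> nat \<Rightarrow> nat \<Rightarrow> nat" where
  "test_cost T c m L = card T * card (fronts T) * (2 * card T + 3) +
     m * ((L + 1) * (card (states T c) * reach_cost T c)) + 2"

lemma computes_improvable:
  assumes T: "finite T" and A: "\<And>C. A C \<subseteq> T" and Q: "\<And>C. Q C \<subseteq> T" and H: "finite H"
    and h: "\<And>h S. h \<in> H \<Longrightarrow> S \<in> T \<Longrightarrow> h ` S \<subseteq> {..<c}"
  shows "computes (test_cost T c (card H) L) (member_preds T A \<union> member_preds T Q) {\<lambda>C. improvable T H L (A C) (Q C)}"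
proof -
  let ?R = "\<Union>h\<in>H. \<Union>l\<le>L. reach_bits T c A Q h l"
  define g where "g = (\<lambda>C. improvable T H L (A C) (Q C))"
  have 1: "computes (card T * card (fronts T) * (2 * card T + 3)) (member_preds T A \<union> member_preds T Q) (probes T A Q)"
    by (rule computes_probes[OF T A])
  have "computes (card H * ((L + 1) * (card (states T c) * reach_cost T c))) (probes T A Q) ?R"
    by (intro computes_UN computes_reach T Q H h)
  then have "computes (card H * ((L + 1) * (card (states T c) * reach_cost T c)))
      ((member_preds T A \<union> member_preds T Q) \<union> probes T A Q) ?R" by (rule computes_mono) auto
  note 2 = computes_trans[OF 1 this]
  \<comment> \<open>The bits that signal success: a set without neighbours, or a state with at most
    one token.\<close>
  define F' where "F' = (\<lambda>e. probe A Q e {}) ` T \<union>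
    {reach_bit T A Q h l x | h l x. h \<in> H \<and> l \<le> L \<and> x \<in> states T c \<and> card (fst x) \<le> 1}"
  have "computes 2 ((member_preds T A \<union> member_preds T Q) \<union> (probes T A Q \<union> ?R)) {g}"
  proof (rule computes_or'[of F'])
    have "{} \<in> fronts T" by (simp add: fronts_def)
    then have "(\<lambda>e. probe A Q e {}) ` T \<subseteq> probes T A Q" using probe_in_probes[of _ T "{}" A Q] by blast
    moreover have "{reach_bit T A Q h l x | h l x. h \<in> H \<and> l \<le> L \<and> x \<in> states T c \<and> card (fst x) \<le> 1} \<subseteq> ?R"
      unfolding reach_bits_def by blast
    ultimately have "F' \<subseteq> probes T A Q \<union> ?R" unfolding F'_def by (rule Un_mono)
    then show "F' \<subseteq> (member_preds T A \<union> member_preds T Q) \<union> (probes T A Q \<union> ?R)" by (rule le_supI2)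
    fix C
    have st: "x \<in> states T c" if hH: "h \<in> H" and r: "x \<in> reach T h (A C) (Q C) l" for h x l
    proof -
      obtain F D where x: "x = (F, D)" by (cases x)
      have "F \<in> fronts T" using reach_fronts[OF T r[unfolded x]] .
      moreover have "h ` \<Union>(Q C) \<subseteq> {..<c}" using h[OF hH] Q by (rule image_Union_subset)
      then have "D \<subseteq> {..<c}" using reach_colours[OF r[unfolded x]] by (rule subset_trans[rotated])
      ultimately show ?thesis by (simp add: states_def x)
    qed
    have "(\<exists>e\<in>Q C. nbrs (A C) e = {}) \<longleftrightarrow> (\<exists>f\<in>(\<lambda>e. probe A Q e {}) ` T. f C)"
      using Q[of C] by (auto simp: probe_def)
    moreover have "(\<exists>h\<in>H. \<exists>l\<le>L. \<exists>(F, D)\<in>reach T h (A C) (Q C) l. card F \<le> 1) \<longleftrightarrow>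
      (\<exists>f\<in>{reach_bit T A Q h l x | h l x. h \<in> H \<and> l \<le> L \<and> x \<in> states T c \<and> card (fst x) \<le> 1}. f C)"
      (is "?l \<longleftrightarrow> ?r")
    proof
      assume ?l
      then obtain h l F D where *: "h \<in> H" "l \<le> L" "(F, D) \<in> reach T h (A C) (Q C) l" "card F \<le> 1" by blast
      show ?r
      proof (rule bexI)
        show "reach_bit T A Q h l (F, D) C" using * by (simp add: reach_bit_def)
        show "reach_bit T A Q h l (F, D) \<in> {reach_bit T A Q h l x | h l x. h \<in> H \<and> l \<le> L \<and> x \<in> states T c \<and> card (fst x) \<le> 1}"
          unfolding mem_Collect_eq using * st[OF *(1,3)] by (intro exI[of _ h] exI[of _ l] exI[of _ "(F, D)"]) simp
      qed
    next
      assume ?r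
      then obtain h l x where *: "h \<in> H" "l \<le> L" "card (fst x) \<le> 1" "reach_bit T A Q h l x C" by blast
      then have "(fst x, snd x) \<in> reach T h (A C) (Q C) l" by (simp add: reach_bit_def)
      then show ?l using * by blast
    qed
    ultimately show "g C \<longleftrightarrow> (\<exists>f\<in>F'. f C)"
      unfolding g_def improvable_def F'_def bex_Un by (simp only:)
  qed
  then have "computes 2 ((member_preds T A \<union> member_preds T Q) \<union> ((member_preds T A \<union> member_preds T Q) \<union> probes T A Q \<union> ?R)) {g}"
    by (rule computes_mono) auto
  from computes_trans'[OF 2 this] show ?thesis unfolding g_def test_cost_def .
qed

section \<open>Circuits for pruning, exchanging and iterating\<close>

lemma computes_remove:
  "computes 2 (member_preds T Q) (member_preds T (\<lambda>C. Q C - {S}))"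
proof -
  define z :: instance_pred where "z = (\<lambda>C. False)"
  have "computes 2 (member_preds T Q) {z}" by (rule computes_or'[of "{}"]) (auto simp: z_def)
  then have "computes 2 (member_preds T Q) (member_preds T Q \<union> {z})"
    using computes_Un[of 0 "member_preds T Q" "member_preds T Q" 2 "{z}"] computes_subset[of "member_preds T Q" "member_preds T Q" 0] by (simp only: add_0)
  moreover have "member_preds T (\<lambda>C. Q C - {S}) \<subseteq> member_preds T Q \<union> {z}"
  proof
    fix f assume "f \<in> member_preds T (\<lambda>C. Q C - {S})"
    then obtain S' where S': "S' \<in> T" "f = member_pred (\<lambda>C. Q C - {S}) S'" by (auto simp: member_preds_def)
    show "f \<in> member_preds T Q \<union> {z}"
    proof (cases "S' = S")
      case True
      then have "f = z" using S' by (simp add: member_pred_def z_def)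
      then show ?thesis by simp
    next
      case False
      then have "f = member_pred Q S'" using S' by (simp add: member_pred_def)
      then show ?thesis using S'(1) member_pred_in_member_preds by blast
    qed
  qed
  ultimately show ?thesis by (rule computes_mono[OF _ order_refl]) auto
qed

text \<open>Each deletion attempt changes the bit of one set only. Its cost is one test, two gates
  for the constant false in the tentative family, and five gates to update that bit.\<close>

lemma computes_prune:
  assumes T: "finite T" and A: "\<And>C. A C \<subseteq> T" and H: "finite H"
    and h: "\<And>h S. h \<in> H \<Longrightarrow> S \<in> T \<Longrightarrow> h ` S \<subseteq> {..<c}"
  shows "(\<And>C. Q C \<subseteq> T) \<Longrightarrow> computes (length Ss * (test_cost T c (card H) L + 7)) (member_preds T A \<union> member_preds T Q)
    (member_preds T (\<lambda>C. prune (improvable T H L (A C)) Ss (Q C)))"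
proof (induction Ss arbitrary: Q)
  case Nil
  then show ?case by (simp add: computes_subset)
next
  case (Cons S Ss)
  let ?\<tau> = "test_cost T c (card H) L"
  define Q' where "Q' = (\<lambda>C. Q C - {S})"
  define t where "t = (\<lambda>C. improvable T H L (A C) (Q' C))"
  define Q'' where "Q'' = (\<lambda>C. if t C then Q' C else Q C)"
  have sub: "Q' C \<subseteq> T" "Q'' C \<subseteq> T" for C using Cons.prems[of C] by (auto simp: Q'_def Q''_def)
  let ?F = "member_preds T A \<union> member_preds T Q"
  have "computes 2 ?F (member_preds T Q')" unfolding Q'_def by (rule computes_mono[OF computes_remove[of T Q S]]) auto
  moreover have "computes ?\<tau> (?F \<union> member_preds T Q') {t}"
    unfolding t_def by (rule computes_mono[OF computes_improvable[OF T A sub(1) H h]]) auto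
  ultimately have 1: "computes (2 + ?\<tau>) ?F {t}" by (rule computes_trans')
  \<comment> \<open>\<open>S\<close> survives exactly when it was present and the test without it
    failed; all other bits are taken over.\<close>
  have "computes (2 + 1 + 2) {member_pred Q S, t} {member_pred Q'' S}"
    by (rule computes_dnf'[where I = "{()}" and P = "\<lambda>_. {member_pred Q S}" and Q = "\<lambda>_. {t}"])
      (auto simp: card_insert_if member_pred_iff Q''_def Q'_def)
  moreover have other: "member_pred Q'' S' = member_pred Q S'" if "S' \<noteq> S" for S'
    using that by (simp add: member_pred_def Q''_def Q'_def)
  ultimately have 2: "computes 5 (?F \<union> {t}) (member_preds T Q'')"
  proof (cases "S \<in> T")
    case True
    have "computes 5 (?F \<union> {t}) {member_pred Q'' S}"
      using \<open>computes (2 + 1 + 2) {member_pred Q S, t} {member_pred Q'' S}\<close>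
      by (rule computes_mono) (use True member_pred_in_member_preds in auto)
    moreover have "computes 0 (?F \<union> {t}) (member_preds T Q)" by (rule computes_subset) auto
    ultimately have "computes (0 + 5) (?F \<union> {t}) (member_preds T Q \<union> {member_pred Q'' S})"
      by (rule computes_Un[rotated])
    moreover have "member_preds T Q'' \<subseteq> member_preds T Q \<union> {member_pred Q'' S}"
    proof
      fix f assume "f \<in> member_preds T Q''"
      then obtain S' where "S' \<in> T" "f = member_pred Q'' S'" by (auto simp: member_preds_def)
      then show "f \<in> member_preds T Q \<union> {member_pred Q'' S}" using other[of S'] by (cases "S' = S") (simp_all add: member_preds_def)
    qed
    ultimately show ?thesis by (rule computes_mono[OF _ order_refl]) auto
  next
    case False
    then have "member_preds T Q'' = member_preds T Q" using other unfolding member_preds_def by (intro image_cong refl) metis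
    then have "member_preds T Q'' \<subseteq> ?F \<union> {t}" by auto
    then show ?thesis by (rule computes_subset)
  qed
  have 3: "computes (2 + ?\<tau> + 5) ?F (member_preds T Q'')" by (rule computes_trans'[OF 1 2])
  have "computes (length Ss * (?\<tau> + 7)) (?F \<union> member_preds T Q'') (member_preds T (\<lambda>C. prune (improvable T H L (A C)) Ss (Q'' C)))"
    by (rule computes_mono[OF Cons.IH[of Q'', OF sub(2)]]) auto
  from computes_trans'[OF 3 this]
  have "computes (2 + ?\<tau> + 5 + length Ss * (?\<tau> + 7)) ?F (member_preds T (\<lambda>C. prune (improvable T H L (A C)) Ss (Q'' C)))" .
  moreover have "(\<lambda>C. prune (improvable T H L (A C)) Ss (Q'' C)) = (\<lambda>C. prune (improvable T H L (A C)) (S # Ss) (Q C))"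
    unfolding Q''_def t_def Q'_def by simp
  moreover have "2 + ?\<tau> + 5 + length Ss * (?\<tau> + 7) = length (S # Ss) * (?\<tau> + 7)" by simp
  ultimately show ?case by (simp only:)
qed

text \<open>The summands pay for the test, the pruning, the suppression of the pruned family if the
  test fails, and the exchange.\<close>

definition step_cost :: "nat set set \<Rightarrow> nat \<Rightarrow> nat \<Rightarrow> nat \<Rightarrow> nat" where
  "step_cost T c m L = test_cost T c m L + card T * (test_cost T c m L + 7) + card T * 5 + card T * (2 * card T + 4)"

lemma computes_step:
  assumes T: "finite T" and A: "\<And>C. A C \<subseteq> T" and Q: "\<And>C. Q C \<subseteq> T" and H: "finite H"
    and h: "\<And>h S. h \<in> H \<Longrightarrow> S \<in> T \<Longrightarrow> h ` S \<subseteq> {..<c}" and Ss: "length Ss = card T"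
  shows "computes (step_cost T c (card H) L) (member_preds T A \<union> member_preds T Q) (member_preds T (\<lambda>C. local_step T H L Ss (A C) (Q C)))"
proof -
  let ?F = "member_preds T A \<union> member_preds T Q" and ?\<tau> = "test_cost T c (card H) L"
  define t where "t = (\<lambda>C. improvable T H L (A C) (Q C))"
  define Y where "Y = (\<lambda>C. prune (improvable T H L (A C)) Ss (Q C))"
  define X where "X = (\<lambda>C. if t C then Y C else {})"
  define A' where "A' = (\<lambda>C. exchange (X C) (A C))"
  have XT: "X C \<subseteq> T" for C using prune_subset[of "improvable T H L (A C)" Ss "Q C"] Q[of C] by (auto simp: X_def Y_def)
  have "computes (?\<tau> + card T * (?\<tau> + 7)) ?F ({t} \<union> member_preds T Y)"
    unfolding t_def Y_def using computes_prune[OF T A H h Q, of Ss L] Ss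
    by (intro computes_Un computes_improvable T A Q H h) auto
  moreover have "computes (card T * 5) (?F \<union> ({t} \<union> member_preds T Y)) (member_preds T X)"
  proof (rule computes_member_preds[OF T])
    fix S assume S: "S \<in> T"
    have "computes (2 + 1 + 2) {member_pred Y S, t} {member_pred X S}"
      by (rule computes_dnf'[where I = "{()}" and P = "\<lambda>_. {member_pred Y S, t}" and Q = "\<lambda>_. {}"])
        (auto simp: card_insert_if member_pred_iff X_def)
    then show "computes 5 (?F \<union> ({t} \<union> member_preds T Y)) {member_pred X S}"
      by (rule computes_mono) (use S member_pred_in_member_preds in auto)
  qed
  ultimately have 1: "computes (?\<tau> + card T * (?\<tau> + 7) + card T * 5) ?F (member_preds T X)" by (rule computes_trans')
  have "computes (card T * (2 * card T + 4)) (?F \<union> member_preds T X) (member_preds T A')"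
  proof (rule computes_member_preds[OF T])
    fix S assume S: "S \<in> T"
    \<comment> \<open>The Boolean index picks one of two terms: \<open>S\<close> is brought in by
      \<open>X\<close>, or \<open>S\<close> was in the packing and meets no member of
      \<open>X\<close>.\<close>
    define P where "P = (\<lambda>i. {if i then member_pred X S else member_pred A S})"
    define N where "N = (\<lambda>i. if i then {} else member_pred X ` {b \<in> T. S \<inter> b \<noteq> {}})"
    have "computes (2 * card T + 2 + 2) (member_preds T A \<union> member_preds T X) {member_pred A' S}"
    proof (rule computes_dnf'[where I = UNIV and P = P and Q = N])
      show "card (member_preds T A \<union> member_preds T X) \<le> 2 * card T"
        using card_Un_le[of "member_preds T A" "member_preds T X"] card_member_preds_le[OF T, of A] card_member_preds_le[OF T, of X] by simp
      show "finite (member_preds T A \<union> member_preds T X)" using T finite_member_preds by blast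
      show "P i \<subseteq> member_preds T A \<union> member_preds T X \<and> N i \<subseteq> member_preds T A \<union> member_preds T X" for i
        using S by (auto simp: P_def N_def member_preds_def)
      fix C
      show "member_pred A' S C \<longleftrightarrow> (\<exists>i\<in>UNIV. (\<forall>f\<in>P i. f C) \<and> (\<forall>f\<in>N i. \<not> f C))"
        using XT[of C] by (auto simp: UNIV_bool P_def N_def member_pred_iff A'_def exchange_def)
    qed (auto simp: UNIV_bool)
    then show "computes (2 * card T + 4) (?F \<union> member_preds T X) {member_pred A' S}" by (rule computes_mono) auto
  qed
  from computes_trans'[OF 1 this]
  have "computes (step_cost T c (card H) L) ?F (member_preds T A')" unfolding step_cost_def .
  moreover have "A' = (\<lambda>C. local_step T H L Ss (A C) (Q C))"
    unfolding A'_def X_def t_def Y_def local_step_def by simp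
  ultimately show ?thesis by simp
qed

text \<open>Gates are functions of arbitrary families, so the input is cut down to \<open>T\<close>;
  this keeps every intermediate family inside \<open>T\<close>. The two extra gates give the
  constant false for the empty starting packing.\<close>

lemma computes_local_search:
  assumes T: "finite T" and Ss: "set Ss = T" "length Ss = card T" and H: "finite H"
    and h: "\<And>h S. h \<in> H \<Longrightarrow> S \<in> T \<Longrightarrow> h ` S \<subseteq> {..<c}" and ne: "\<And>S. S \<in> T \<Longrightarrow> S \<noteq> {}"
  shows "computes (i * step_cost T c (card H) L + 2) (member_preds T (\<lambda>C. C \<inter> T))
    (member_preds T (\<lambda>C. local_search T H L Ss (C \<inter> T) i))"
proof (induction i)
  case 0
  define z :: instance_pred where "z = (\<lambda>C. False)"
  have "computes 2 (member_preds T (\<lambda>C. C \<inter> T)) {z}" by (rule computes_or'[of "{}"]) (auto simp: z_def)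
  moreover have "member_preds T (\<lambda>C. local_search T H L Ss (C \<inter> T) 0) \<subseteq> {z}" by (auto simp: member_preds_def member_pred_def z_def)
  ultimately show ?case by (rule computes_mono[OF _ order_refl]) auto
next
  case (Suc i)
  have "local_search T H L Ss (C \<inter> T) i \<subseteq> C \<inter> T" for C
    by (rule local_search_optimal(1)[OF T Ss(1) Int_lower2 ne, THEN conjunct1])
  then have sub: "local_search T H L Ss (C \<inter> T) i \<subseteq> T" for C by simp
  let ?A = "\<lambda>C. local_search T H L Ss (C \<inter> T) i"
  have "computes (step_cost T c (card H) L) (member_preds T ?A \<union> member_preds T (\<lambda>C. C \<inter> T))
      (member_preds T (\<lambda>C. local_step T H L Ss (?A C) (C \<inter> T)))"
    by (rule computes_step[OF T sub _ H h Ss(2)]) auto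
  then have "computes (step_cost T c (card H) L) (member_preds T (\<lambda>C. C \<inter> T) \<union> member_preds T ?A)
      (member_preds T (\<lambda>C. local_search T H L Ss (C \<inter> T) (Suc i)))" by (simp add: Un_commute)
  from computes_trans'[OF Suc.IH this] show ?case by (simp add: algebra_simps)
qed

section \<open>The relaxation\<close>

definition poly_bounded :: "(nat \<Rightarrow> nat) \<Rightarrow> bool" where
  "poly_bounded f \<longleftrightarrow> (\<exists>p :: nat poly. \<forall>n. f n \<le> poly p n)"

named_theorems poly_bounded_intros

lemma poly_bounded_mono: "poly_bounded g \<Longrightarrow> (\<And>n. f n \<le> g n) \<Longrightarrow> poly_bounded f"
  unfolding poly_bounded_def by (meson order_trans)

lemma poly_bounded_const [poly_bounded_intros]: "poly_bounded (\<lambda>_. c)"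
  unfolding poly_bounded_def by (intro exI[of _ "[:c:]"]) simp

lemma poly_bounded_id [poly_bounded_intros]: "poly_bounded (\<lambda>n. n)"
  unfolding poly_bounded_def by (intro exI[of _ "[:0, 1:]"]) simp

lemma poly_bounded_add [poly_bounded_intros]:
  assumes "poly_bounded f" "poly_bounded g" shows "poly_bounded (\<lambda>n. f n + g n)"
proof -
  obtain p q where "\<forall>n. f n \<le> poly p n" "\<forall>n. g n \<le> poly q n" using assms by (auto simp: poly_bounded_def)
  then show ?thesis unfolding poly_bounded_def by (intro exI[of _ "p + q"]) (simp add: add_mono)
qed

lemma poly_bounded_mult [poly_bounded_intros]:
  assumes "poly_bounded f" "poly_bounded g" shows "poly_bounded (\<lambda>n. f n * g n)"
proof -
  obtain p q where "\<forall>n. f n \<le> poly p n" "\<forall>n. g n \<le> poly q n" using assms by (auto simp: poly_bounded_def)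
  then show ?thesis unfolding poly_bounded_def by (intro exI[of _ "p * q"]) (simp add: mult_mono)
qed

lemma poly_bounded_power [poly_bounded_intros]: "poly_bounded f \<Longrightarrow> poly_bounded (\<lambda>n. f n ^ m)"
  by (induction m) (auto intro: poly_bounded_intros)

text \<open>Up to renaming, the sets that can occur in an instance with \<open>n\<close> sets of
  size \<open>k\<close>. For fixed \<open>k\<close> their number is polynomial, so each can have its
  own bit.\<close>

definition ksets :: "nat \<Rightarrow> nat \<Rightarrow> nat set set" where
  "ksets k n = {S. S \<subseteq> {..<k * n} \<and> card S = k}"

lemma finite_ksets: "finite (ksets k n)"
  unfolding ksets_def by (rule finite_subset[of _ "Pow {..<k * n}"]) auto

lemma card_ksets_le: "card (ksets k n) \<le> (k * n) ^ k"
proof -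
  have "ksets k n \<subseteq> set ` {xs. set xs \<subseteq> {..<k * n} \<and> length xs = k}"
  proof
    fix S assume S: "S \<in> ksets k n"
    then have "finite S" by (auto simp: ksets_def intro: finite_subset)
    then obtain xs where "set xs = S" "distinct xs" using finite_distinct_list by blast
    then show "S \<in> set ` {xs. set xs \<subseteq> {..<k * n} \<and> length xs = k}"
      using S distinct_card[of xs] by (intro image_eqI[of _ _ xs]) (auto simp: ksets_def)
  qed
  then have "card (ksets k n) \<le> card {xs. set xs \<subseteq> {..<k * n} \<and> length xs = k}"
    using finite_lists_length_eq[of "{..<k * n}" k] by (intro surj_card_le) auto
  then show ?thesis by (simp add: card_lists_length_eq)
qed

lemma card_fronts_le:
  assumes T: "finite T" shows "card (fronts T) \<le> 5 * (card T + 1) ^ 4"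
proof -
  have "fronts T \<subseteq> set ` {xs. set xs \<subseteq> T \<and> length xs \<le> 4}"
  proof
    fix F assume F: "F \<in> fronts T"
    then have "finite F" using T by (auto simp: fronts_def intro: finite_subset)
    then obtain xs where "set xs = F" "distinct xs" using finite_distinct_list by blast
    then show "F \<in> set ` {xs. set xs \<subseteq> T \<and> length xs \<le> 4}"
      using F distinct_card[of xs] by (intro image_eqI[of _ _ xs]) (auto simp: fronts_def)
  qed
  then have "card (fronts T) \<le> card {xs. set xs \<subseteq> T \<and> length xs \<le> 4}"
    using finite_lists_length_le[OF T, of 4] by (intro surj_card_le) auto
  also have "\<dots> = (\<Sum>i\<le>4. card T ^ i)" using T by (rule card_lists_length_le)
  also have "\<dots> \<le> (\<Sum>i\<le>(4::nat). (card T + 1) ^ 4)"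
  proof (rule sum_mono)
    fix i :: nat assume "i \<in> {..4}"
    have "card T ^ i \<le> (card T + 1) ^ i" by (rule power_mono) auto
    also have "\<dots> \<le> (card T + 1) ^ 4" using \<open>i \<in> {..4}\<close> by (intro power_increasing) auto
    finally show "card T ^ i \<le> (card T + 1) ^ 4" .
  qed
  finally show ?thesis by simp
qed

text \<open>A logarithm rounded up: the first bound makes \<open>d\<close> a sufficient search
  depth, the second turns a fixed power of \<open>2 ^ d\<close> into a polynomial.\<close>

lemma log_exponent: "\<exists>d. n < 2 ^ d \<and> (2::nat) ^ d \<le> 2 * n + 2"
proof (induction n)
  case (Suc n)
  then obtain d where d: "n < 2 ^ d" "2 ^ d \<le> 2 * n + 2" by blast
  show ?case
  proof (cases "Suc n < 2 ^ d")
    case True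
    then show ?thesis using d by (intro exI[of _ d]) auto
  next
    case False
    then show ?thesis using d by (intro exI[of _ "Suc d"]) auto
  qed
qed (intro exI[of _ 0], simp)

text \<open>For each \<open>n\<close> a perfect hash family is fixed by its mere existence and built
  into the circuit. The exponential factors in the cost are bounded by a fixed power of
  \<open>2 ^ d n\<close>, up to a constant, hence by a polynomial since \<open>k\<close> is
  fixed.\<close>

lemma local_search_circuits:
  assumes k: "k > 0"
  shows "\<exists>p :: nat poly. \<forall>n. \<exists>xs A. circuit xs \<and> length xs \<le> poly p n \<and> member_preds (ksets k n) A \<subseteq> set xs \<and>
    (\<forall>C\<subseteq>ksets k n. card C = n \<longrightarrow> A C \<subseteq> C \<and> disjoint (A C) \<and>
      (\<forall>B\<subseteq>C. disjoint B \<longrightarrow> 3 * card B \<le> (k + 3) * card (A C)))"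
proof -
  obtain d :: "nat \<Rightarrow> nat" where d: "\<And>n. n < 2 ^ d n" "\<And>n. 2 ^ d n \<le> 2 * n + 2" using log_exponent by metis
  \<comment> \<open>The largest number of elements covered by the \<open>4 * d n + 2\<close> sets of
    one search.\<close>
  define q where "q n = k * (4 * d n + 2)" for n
  have q: "q n > 0" for n using k by (simp add: q_def)
  define U where "U n = {..<k * n}" for n
  have "\<forall>n. \<exists>H. finite H \<and> card H \<le> 2 ^ q n * (card (U n) + 1) \<and> (\<forall>h\<in>H. h ` U n \<subseteq> {..<2 * q n}) \<and>
    (\<forall>Y\<subseteq>U n. card Y \<le> q n \<longrightarrow> (\<exists>h\<in>H. inj_on h Y))"
    using q by (intro allI perfect_hash_family) (simp_all add: U_def)
  then obtain H :: "nat \<Rightarrow> (nat \<Rightarrow> nat) set" where H: "\<And>n. finite (H n)" "\<And>n. card (H n) \<le> 2 ^ q n * (card (U n) + 1)"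
    "\<And>n h. h \<in> H n \<Longrightarrow> h ` U n \<subseteq> {..<2 * q n}"
    "\<And>n Y. Y \<subseteq> U n \<Longrightarrow> card Y \<le> q n \<Longrightarrow> \<exists>h\<in>H n. inj_on h Y" by metis
  let ?T = "ksets k"
  have T: "finite (?T n)" for n by (rule finite_ksets)
  have TU: "S \<subseteq> U n \<and> card S = k" if "S \<in> ?T n" for S n using that by (auto simp: ksets_def U_def)
  have ne: "S \<noteq> {}" if "S \<in> ?T n" for S n using TU[OF that] k by auto
  define L where "L n = 4 * d n" for n
  define len where "len n = card (?T n) * 1 + ((n + 1) * step_cost (?T n) (2 * q n) (card (H n)) (L n) + 2)" for n
  have "poly_bounded len"
  proof -
    have bT: "poly_bounded (\<lambda>n. card (?T n))"
      by (rule poly_bounded_mono[OF _ card_ksets_le]) (intro poly_bounded_intros)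
    have bF: "poly_bounded (\<lambda>n. card (fronts (?T n)))"
      by (rule poly_bounded_mono[OF _ card_fronts_le[OF T]]) (intro poly_bounded_intros bT)
    have b2: "poly_bounded (\<lambda>n. 2 ^ (2 * q n))"
    proof (rule poly_bounded_mono)
      show "poly_bounded (\<lambda>n. (2 * n + 2) ^ (8 * k) * 2 ^ (4 * k))" by (intro poly_bounded_intros)
      fix n
      \<comment> \<open>Here \<open>2 * q n = 8 * k * d n + 4 * k\<close>.\<close>
      have "(2::nat) ^ (2 * q n) = (2 ^ d n) ^ (8 * k) * 2 ^ (4 * k)"
        by (simp add: q_def algebra_simps flip: power_mult power_add)
      also have "\<dots> \<le> (2 * n + 2) ^ (8 * k) * 2 ^ (4 * k)" using d(2) by (intro mult_le_mono1 power_mono) auto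
      finally show "(2::nat) ^ (2 * q n) \<le> (2 * n + 2) ^ (8 * k) * 2 ^ (4 * k)" .
    qed
    have "card (H n) \<le> 2 ^ (2 * q n) * (k * n + 1)" for n
    proof -
      have "(2::nat) ^ q n \<le> 2 ^ (2 * q n)" by (rule power_increasing) auto
      then have "2 ^ q n * (k * n + 1) \<le> 2 ^ (2 * q n) * (k * n + 1)" by (rule mult_le_mono1)
      then show ?thesis using H(2)[of n] unfolding U_def card_lessThan by (rule order_trans[rotated])
    qed
    then have bH: "poly_bounded (\<lambda>n. card (H n))"
      by (rule poly_bounded_mono[rotated]) (intro poly_bounded_intros b2)
    have bS: "poly_bounded (\<lambda>n. card (states (?T n) (2 * q n)))"
      by (simp add: states_def card_cartesian_product card_Pow) (intro poly_bounded_intros bF b2)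
    have bL: "poly_bounded L"
    proof (rule poly_bounded_mono)
      show "poly_bounded (\<lambda>n. 4 * (2 * n + 2))" by (intro poly_bounded_intros)
      fix n
      have "d n \<le> 2 * n + 2" using less_imp_le[OF less_exp] d(2) by (rule order_trans)
      then show "L n \<le> 4 * (2 * n + 2)" unfolding L_def by (rule mult_le_mono2)
    qed
    show ?thesis unfolding len_def step_cost_def test_cost_def reach_cost_def
      by (intro poly_bounded_intros bT bF bH bS bL)
  qed
  then obtain p :: "nat poly" where p: "\<And>n. len n \<le> poly p n" unfolding poly_bounded_def by blast
  have "\<exists>xs A. circuit xs \<and> length xs \<le> poly p n \<and> member_preds (?T n) A \<subseteq> set xs \<and>
    (\<forall>C\<subseteq>?T n. card C = n \<longrightarrow> A C \<subseteq> C \<and> disjoint (A C) \<and>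
      (\<forall>B\<subseteq>C. disjoint B \<longrightarrow> 3 * card B \<le> (k + 3) * card (A C)))" for n
  proof -
    obtain Ss where Ss: "set Ss = ?T n" "length Ss = card (?T n)"
      using finite_distinct_list[OF T] distinct_card by metis
    define A where "A = (\<lambda>C. local_search (?T n) (H n) (L n) Ss (C \<inter> ?T n) (n + 1))"
    have hT: "h ` S \<subseteq> {..<2 * q n}" if "h \<in> H n" "S \<in> ?T n" for h S
      using H(3)[OF that(1)] TU[OF that(2)] by (meson image_mono order_trans)
    have "computes (card (?T n) * 1) {} (member_preds (?T n) (\<lambda>C. C \<inter> ?T n))"
    proof (rule computes_member_preds[OF T])
      fix S assume "S \<in> ?T n"
      then have "member_pred (\<lambda>C. C \<inter> ?T n) S = (\<lambda>C. S \<in> C)" by (simp add: member_pred_def)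
      then show "computes 1 {} {member_pred (\<lambda>C. C \<inter> ?T n) S}" using computes_input by metis
    qed
    moreover have "computes ((n + 1) * step_cost (?T n) (2 * q n) (card (H n)) (L n) + 2)
        ({} \<union> member_preds (?T n) (\<lambda>C. C \<inter> ?T n)) (member_preds (?T n) A)"
      unfolding A_def Un_empty_left by (rule computes_local_search[OF T Ss H(1) hT ne])
    ultimately have "computes (len n) {} (member_preds (?T n) A)"
      unfolding len_def by (rule computes_trans')
    then obtain xs where xs: "circuit xs" "length xs \<le> len n" "member_preds (?T n) A \<subseteq> set xs"
      using circuit.Nil unfolding computes_def by (metis append_Nil empty_subsetI)
    have "A C \<subseteq> C \<and> disjoint (A C) \<and> (\<forall>B\<subseteq>C. disjoint B \<longrightarrow> 3 * card B \<le> (k + 3) * card (A C))"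
      if C: "C \<subseteq> ?T n" "card C = n" for C
    proof -
      have AC: "A C = local_search (?T n) (H n) (L n) Ss C (card C + 1)"
        unfolding A_def using C by (simp add: Int_absorb2)
      have A: "A C \<subseteq> C" "disjoint (A C)" "\<not> improvable (?T n) (H n) (L n) (A C) C"
        unfolding AC using local_search_optimal(1)[OF T Ss(1) C(1) ne[of _ n], of "H n" "L n" "card C + 1"]
          local_search_optimal(2)[OF T Ss(1) C(1) ne[of _ n], of "H n" "L n"] by simp_all
      have "card (A C) \<le> n" using A(1) C finite_subset[OF C(1) T] card_mono by metis
      then have c: "card (A C) < 2 ^ d n" using d(1)[of n] by linarith
      have "3 * card B \<le> (k + 3) * card (A C)" if B: "B \<subseteq> C" "disjoint B" for B
      proof (rule local_optimum_bound[OF k _ _ _ _ c C(1) B])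
        show "S \<subseteq> U n \<and> card S = k" if "S \<in> ?T n" for S using TU[OF that] .
        show "finite (U n)" by (simp add: U_def)
        show "\<exists>h\<in>H n. inj_on h Y" if "Y \<subseteq> U n" "card Y \<le> k * (4 * d n + 2)" for Y
          using H(4)[of Y n] that by (simp add: q_def)
        show "A C \<subseteq> ?T n" using A(1) C(1) by simp
        show "\<not> improvable (?T n) (H n) (4 * d n) (A C) C" using A(3) by (simp add: L_def)
      qed
      then show ?thesis using A by blast
    qed
    then show ?thesis using xs p[of n] by (intro exI[of _ xs] exI[of _ A]) auto
  qed
  then show ?thesis by blast
qed

text \<open>The rank of an element in the union is strictly increasing, hence injective on the
  union; so it preserves cardinalities and disjointness, and packings correspond.\<close>

lemma normalize_sets_props:
  assumes inst: "set_packing_instance k U C"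
  shows "normalize_sets C \<subseteq> ksets k (card C)" and "card (normalize_sets C) = card C"
    and "max_packing (normalize_sets C) = max_packing C"
proof -
  define \<phi> where "\<phi> v = card {u \<in> \<Union>C. u < v}" for v
  have C: "finite C" "\<And>S. S \<in> C \<Longrightarrow> card S = k" "finite (\<Union>C)"
    using inst unfolding set_packing_instance_def by (auto intro: finite_subset)
  have nC: "normalize_sets C = (\<lambda>S. \<phi> ` S) ` C" by (simp add: normalize_sets_def \<phi>_def)
  have mono: "\<phi> u < \<phi> v" if "u \<in> \<Union>C" "u < v" for u v
    unfolding \<phi>_def using C(3) that by (intro psubset_card_mono) auto
  have inj: "inj_on \<phi> (\<Union>C)"
    by (rule linorder_inj_onI) (use mono in fastforce)+
  have inj2: "inj_on ((`) \<phi>) C"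
    by (rule inj_on_subset[OF inj_on_image_Pow[OF inj]]) auto
  \<comment> \<open>A rank is below the size of the union, which is at most the sum of the
    \<open>card C\<close> set sizes.\<close>
  have lt: "\<phi> v < k * card C" if "v \<in> \<Union>C" for v
  proof -
    have "\<phi> v < card (\<Union>C)" unfolding \<phi>_def using C(3) that by (intro psubset_card_mono) auto
    also have "\<dots> \<le> (\<Sum>S\<in>C. card S)" by (rule card_Union_le_sum_card)
    also have "\<dots> = (\<Sum>S\<in>C. k)" using C(2) by (intro sum.cong) auto
    finally show ?thesis by (simp add: mult.commute)
  qed
  show "normalize_sets C \<subseteq> ksets k (card C)"
  proof
    fix S' assume "S' \<in> normalize_sets C"
    then obtain S where S: "S \<in> C" "S' = \<phi> ` S" by (auto simp: nC)
    have "card (\<phi> ` S) = card S" using inj S(1) by (intro card_image) (meson Union_upper inj_on_subset)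
    then show "S' \<in> ksets k (card C)" using S lt C(2) by (auto simp: ksets_def)
  qed
  show "card (normalize_sets C) = card C" unfolding nC using inj2 by (rule card_image)
  have dis: "disjoint ((`) \<phi> ` P) \<longleftrightarrow> disjoint P" if P: "P \<subseteq> C" for P
  proof
    have iP: "inj_on \<phi> (\<Union>P)" using inj P by (meson Union_mono inj_on_subset)
    then show "disjoint ((`) \<phi> ` P)" if "disjoint P" using that by (rule disjoint_image)
    show "disjoint P" if d: "disjoint ((`) \<phi> ` P)"
    proof (rule disjointI)
      fix a b assume ab: "a \<in> P" "b \<in> P" "a \<noteq> b"
      then have "\<phi> ` a \<noteq> \<phi> ` b" using inj2 P by (meson inj_onD subsetD)
      then have "\<phi> ` a \<inter> \<phi> ` b = {}" using disjointD[OF d] ab by blast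
      then show "a \<inter> b = {}" by auto
    qed
  qed
  have "packings (normalize_sets C) = (`) ((`) \<phi>) ` packings C"
  proof (intro equalityI subsetI)
    fix P' assume "P' \<in> packings (normalize_sets C)"
    then have P': "P' \<subseteq> (`) \<phi> ` C" "disjoint P'" by (auto simp: packings_def nC)
    then obtain P where "P \<subseteq> C" "P' = (`) \<phi> ` P" by (auto simp: subset_image_iff)
    then show "P' \<in> (`) ((`) \<phi>) ` packings C" using P' dis by (auto simp: packings_def)
  next
    fix P' assume "P' \<in> (`) ((`) \<phi>) ` packings C"
    then obtain P where P: "P' = (`) \<phi> ` P" "P \<subseteq> C" "disjoint P" unfolding packings_def by blast
    then show "P' \<in> packings (normalize_sets C)" using dis[of P] by (auto simp: packings_def nC)
  qed
  moreover have "card ((`) \<phi> ` P) = card P" if "P \<in> packings C" for P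
    using that inj2 by (intro card_image) (auto simp: packings_def intro: inj_on_subset)
  ultimately have "card ` packings (normalize_sets C) = card ` packings C"
    by (simp add: image_image)
  then show "max_packing (normalize_sets C) = max_packing C" by (simp add: max_packing_def)
qed

lemma card_le_max_packing:
  assumes "finite C" "P \<subseteq> C" "disjoint P" shows "card P \<le> max_packing C"
proof -
  have "finite (packings C)" using assms(1) by (auto simp: packings_def)
  then show ?thesis unfolding max_packing_def using assms by (intro Max_ge) (auto simp: packings_def)
qed

lemma max_packing_attained:
  assumes "finite C" shows "\<exists>P\<subseteq>C. disjoint P \<and> card P = max_packing C"
proof -
  have "finite (packings C)" using assms(1) by (auto simp: packings_def)
  moreover have "{} \<in> packings C" by (simp add: packings_def)
  ultimately have "max_packing C \<in> card ` packings C" unfolding max_packing_def by (intro Max_in) auto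
  then show ?thesis by (auto simp: packings_def)
qed

text \<open>One bit for the sign and at most \<open>b + 1\<close> digits, as
  \<open>b < 2 ^ b\<close>. This crude linear bound suffices because the coefficients themselves are
  polynomially bounded.\<close>

lemma coeff_size_le:
  assumes "\<bar>a\<bar> \<le> int b" shows "coeff_size a \<le> b + 2"
proof -
  have "\<bar>a\<bar> < 2 ^ nat (int b + 1)"
  proof -
    have "b < 2 ^ b" by (rule less_exp)
    then have "int b < 2 ^ b" by (metis of_nat_less_iff of_nat_numeral of_nat_power)
    moreover have "(2::int) ^ nat (int b + 1) = 2 * 2 ^ b" by (simp add: nat_add_distrib)
    ultimately show ?thesis using assms by linarith
  qed
  then have "bitlen \<bar>a\<bar> \<le> int b + 1" using bitlen_le_iff_power[of "\<bar>a\<bar>" "nat (int b + 1)"] by simp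
  then show ?thesis by (simp add: coeff_size_def nat_le_iff)
qed

lemma lp_size_le:
  assumes "\<And>i j. coeff_size (mat L i j) \<le> K" and "\<And>i. i < num_constrs L \<Longrightarrow> coeff_size (rhs L i) \<le> K"
    and "\<And>j. coeff_size (obj L j) \<le> K"
  shows "lp_size L \<le> num_constrs L * (num_vars L * K) + num_constrs L * K + num_vars L * K"
proof -
  have "(\<Sum>j<num_vars L. coeff_size (mat L i j)) \<le> num_vars L * K" for i
    using sum_bounded_above[of "{..<num_vars L}" "\<lambda>j. coeff_size (mat L i j)" K] assms(1) by simp
  then have "(\<Sum>i<num_constrs L. \<Sum>j<num_vars L. coeff_size (mat L i j)) \<le> num_constrs L * (num_vars L * K)"
    using sum_bounded_above[of "{..<num_constrs L}" "\<lambda>i. \<Sum>j<num_vars L. coeff_size (mat L i j)" "num_vars L * K"]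
    by simp
  moreover have "(\<Sum>i<num_constrs L. coeff_size (rhs L i)) \<le> num_constrs L * K"
    using sum_bounded_above[of "{..<num_constrs L}" "\<lambda>i. coeff_size (rhs L i)" K] assms(2) by simp
  moreover have "(\<Sum>j<num_vars L. coeff_size (obj L j)) \<le> num_vars L * K"
    using sum_bounded_above[of "{..<num_vars L}" "\<lambda>j. coeff_size (obj L j)" K] assms(3) by simp
  ultimately show ?thesis unfolding lp_size_def by linarith
qed

text \<open>The last variable is the objective value: three times it is at most \<open>k + 3\<close> times the number
  of output gates that are true. Several outputs may be computed by the same gate.\<close>

lemma circuit_lp:
  assumes xs: "circuit xs" and T: "finite T" and out: "member_preds T A \<subseteq> set xs"
  shows "\<exists>P :: affine_form lp. \<forall>C. finite C \<and> A C \<subseteq> T \<longrightarrow>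
    lp_opt (map_lp (affine_eval C) P) = ereal (real ((k + 3) * card (A C)) / 3) \<and>
    lp_size (map_lp (affine_eval C) P) \<le>
      (let r = length xs * (length xs + 4) + 1; v = length xs + 1; K = (k + 3) * (card T + 1) + 2
       in r * (v * K) + r * K + v * K)"
proof -
  define m where "m = length xs"
  have "\<forall>S\<in>T. \<exists>i<m. xs ! i = member_pred A S"
    using out unfolding member_preds_def m_def by (auto simp: in_set_conv_nth subset_iff)
  then obtain idx where idx: "\<And>S. S \<in> T \<Longrightarrow> idx S < m \<and> xs ! idx S = member_pred A S" by metis
  obtain R where R: "finite R" "card R \<le> m * (m + 1 + 3)" "\<And>r. r \<in> R \<Longrightarrow> small_row r"
    and sat: "\<And>C z. finite C \<Longrightarrow>
      (\<forall>r\<in>R. row_sat (m + 1) C z r) \<longleftrightarrow> (\<forall>i<m. z i = of_bool ((xs ! i) C))"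
    using circuit_rows[OF xs, of "m + 1"] unfolding m_def by auto
  obtain rs where rs: "set rs = R" "length rs = card R"
    using finite_distinct_list[OF R(1)] distinct_card by metis
  define mult where "mult j = card {S \<in> T. idx S = j}" for j
  define out_row :: "(nat \<Rightarrow> int) \<times> affine_form" where
    "out_row = (\<lambda>j. if j = m then 3 else - int ((k + 3) * mult j), const_affine 0)"
  define rows where "rows = rs @ [out_row]"
  \<comment> \<open>The matrix is set to zero beyond the last row because \<open>lp_size_le\<close>
    asks for a bound at all indices.\<close>
  define P where "P = LP (m + 1) (length rows) (\<lambda>i j. const_affine (if i < length rows then fst (rows ! i) j else 0))
    (\<lambda>i. snd (rows ! i)) (\<lambda>j. const_affine (if j = m then 1 else 0))"
  have "lp_opt (map_lp (affine_eval C) P) = ereal (real ((k + 3) * card (A C)) / 3) \<and>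
    lp_size (map_lp (affine_eval C) P) \<le>
      (let r = m * (m + 4) + 1; v = m + 1; K = (k + 3) * (card T + 1) + 2
       in r * (v * K) + r * K + v * K)" if C: "finite C" "A C \<subseteq> T" for C
  proof
    let ?L = "map_lp (affine_eval C) P"
    have sel: "num_vars ?L = m + 1" "num_constrs ?L = length rows"
      "mat ?L i j = (if i < length rows then fst (rows ! i) j else 0)" "rhs ?L i = affine_eval C (snd (rows ! i))"
      "obj ?L j = (if j = m then 1 else 0)" for i j
      by (simp_all add: P_def)
    have val: "lp_value ?L z = z m" for z by (simp add: lp_value_def sel)
    have "lp_feasible ?L z \<longleftrightarrow> (\<forall>i<length rows. row_sat (m + 1) C z (rows ! i))" for z
      unfolding lp_feasible_def sel row_sat_def by (auto simp: case_prod_beta)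
    then have feas': "lp_feasible ?L z \<longleftrightarrow> (\<forall>r\<in>R. row_sat (m + 1) C z r) \<and> row_sat (m + 1) C z out_row" for z
      using rs(1) unfolding all_set_conv_all_nth[symmetric] rows_def by auto
    \<comment> \<open>Group the sets of \<open>T\<close> by the gate that computes their bit;
      \<open>mult j\<close> is the size of a group.\<close>
    have out_sum: "(\<Sum>j<m. real (mult j) * z j) = real (card (A C))" if z: "\<forall>i<m. z i = of_bool ((xs ! i) C)" for z
    proof -
      have "(\<Sum>j<m. real (mult j) * z j) = (\<Sum>j<m. \<Sum>S\<in>{S \<in> T. idx S = j}. z (idx S))"
        by (intro sum.cong) (auto simp: mult_def)
      also have "\<dots> = (\<Sum>S\<in>T. z (idx S))"
        using T idx by (intro sum.group) auto
      also have "\<dots> = (\<Sum>S\<in>T. of_bool (S \<in> A C))"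
        using z idx by (intro sum.cong) (auto simp: member_pred_iff)
      also have "\<dots> = real (card (A C))"
        using T C(2) by (simp add: of_bool_def sum.If_cases Int_absorb1)
      finally show ?thesis .
    qed
    have feas: "lp_feasible ?L z \<longleftrightarrow> (\<forall>i<m. z i = of_bool ((xs ! i) C)) \<and> 3 * z m \<le> real ((k + 3) * card (A C))" for z
    proof -
      have "row_sat (m + 1) C z out_row \<longleftrightarrow> 3 * z m \<le> real ((k + 3) * card (A C))"
        if "\<forall>i<m. z i = of_bool ((xs ! i) C)"
      proof -
        have "(\<Sum>j<m. of_int (if j = m then 3 else - int ((k + 3) * mult j)) * z j) =
          (\<Sum>j<m. - real (k + 3) * (real (mult j) * z j))"
          by (intro sum.cong) (auto simp: algebra_simps)
        also have "\<dots> = - real (k + 3) * (\<Sum>j<m. real (mult j) * z j)"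
          by (rule sum_distrib_left[symmetric])
        also have "\<dots> = - real ((k + 3) * card (A C))" using out_sum[OF that] by (simp add: algebra_simps)
        finally have s: "(\<Sum>j<m. of_int (if j = m then 3 else - int ((k + 3) * mult j)) * z j) =
          - real ((k + 3) * card (A C))" .
        have "row_sat (m + 1) C z out_row \<longleftrightarrow>
          (\<Sum>j<m. of_int (if j = m then 3 else - int ((k + 3) * mult j)) * z j) + 3 * z m \<le> 0"
          unfolding row_sat_def out_row_def by simp
        then show ?thesis unfolding s by linarith
      qed
      then show ?thesis using feas' sat[OF C(1), of z] by blast
    qed
    show "lp_opt ?L = ereal (real ((k + 3) * card (A C)) / 3)"
      unfolding lp_opt_def
    proof (rule antisym)
      show "(SUP x\<in>{x. lp_feasible ?L x}. ereal (lp_value ?L x)) \<le> ereal (real ((k + 3) * card (A C)) / 3)"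
        by (rule SUP_least) (auto simp: val feas)
      define z where "z i = (if i < m then of_bool ((xs ! i) C) else real ((k + 3) * card (A C)) / 3)" for i
      have "lp_feasible ?L z" unfolding feas by (simp add: z_def)
      moreover have "lp_value ?L z = real ((k + 3) * card (A C)) / 3" unfolding val by (simp add: z_def)
      ultimately show "ereal (real ((k + 3) * card (A C)) / 3) \<le> (SUP x\<in>{x. lp_feasible ?L x}. ereal (lp_value ?L x))"
        by (metis SUP_upper mem_Collect_eq)
    qed
    \<comment> \<open>The summand one keeps the bound at least 3 even for empty \<open>T\<close>, so
      that it covers the coefficient of the objective variable.\<close>
    let ?B = "(k + 3) * (card T + 1)"
    have B: "1 \<le> ?B" "3 \<le> ?B" by simp_all
    have rows: "\<bar>fst r j\<bar> \<le> int ?B \<and> \<bar>affine_eval C (snd r)\<bar> \<le> int ?B" if r: "r \<in> set rows" for r j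
    proof (cases "r \<in> R")
      case True
      then have "\<bar>fst r j\<bar> \<le> 1" "\<bar>affine_eval C (snd r)\<bar> \<le> 1"
        using R(3)[OF True] C by (auto simp: small_row_def case_prod_beta)
      then show ?thesis using B by linarith
    next
      case False
      then have r: "r = out_row" using r rs by (auto simp: rows_def)
      have "mult j \<le> card T" unfolding mult_def using T by (intro card_mono) auto
      then have "(k + 3) * mult j \<le> ?B" by (intro mult_le_mono2) simp
      then have "int ((k + 3) * mult j) \<le> int ?B" by (simp only: of_nat_le_iff)
      then show ?thesis using B unfolding r out_row_def by auto
    qed
    have "lp_size ?L \<le> num_constrs ?L * (num_vars ?L * (?B + 2)) + num_constrs ?L * (?B + 2) + num_vars ?L * (?B + 2)"
    proof (rule lp_size_le; rule coeff_size_le)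
      show "\<bar>mat ?L i j\<bar> \<le> int ?B" for i j unfolding sel using rows[of "rows ! i" j] by simp
      show "\<bar>rhs ?L i\<bar> \<le> int ?B" if "i < num_constrs ?L" for i
        using rows[of "rows ! i"] that unfolding sel by simp
      show "\<bar>obj ?L j\<bar> \<le> int ?B" for j unfolding sel by simp
    qed
    also have "\<dots> \<le> (let r = m * (m + 4) + 1; v = m + 1; K = ?B + 2 in r * (v * K) + r * K + v * K)"
    proof -
      have "length rows \<le> m * (m + 4) + 1" using R(2) rs(2) by (simp add: rows_def add.commute)
      then show ?thesis unfolding sel Let_def by (intro add_mono mult_le_mono1 order_refl)
    qed
    finally show "lp_size ?L \<le> (let r = m * (m + 4) + 1; v = m + 1; K = ?B + 2 in r * (v * K) + r * K + v * K)" .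
  qed
  then show ?thesis unfolding m_def by blast
qed

section \<open>The relaxation property, the size and the integrality gap\<close>

theorem theorem19:
  fixes k :: nat and \<epsilon> :: real
  assumes "k > 0" and "\<epsilon> > 0"
  shows "\<exists>R. lp_relaxation k R \<and> polynomial_size k R \<and>
             integrality_gap k R \<le> ereal (real k / 3 + 1 + \<epsilon>)"
proof -
  obtain p :: "nat poly" where "\<forall>n. \<exists>xs A. circuit xs \<and> length xs \<le> poly p n \<and> member_preds (ksets k n) A \<subseteq> set xs \<and>
    (\<forall>C\<subseteq>ksets k n. card C = n \<longrightarrow> A C \<subseteq> C \<and> disjoint (A C) \<and>
      (\<forall>B\<subseteq>C. disjoint B \<longrightarrow> 3 * card B \<le> (k + 3) * card (A C)))"
    using local_search_circuits[OF assms(1)] by blast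
  then obtain xs A where xs: "\<And>n. circuit (xs n)" "\<And>n. length (xs n) \<le> poly p n"
      "\<And>n. member_preds (ksets k n) (A n) \<subseteq> set (xs n)"
    and A: "\<And>n C. C \<subseteq> ksets k n \<Longrightarrow> card C = n \<Longrightarrow> A n C \<subseteq> C \<and> disjoint (A n C) \<and>
      (\<forall>B\<subseteq>C. disjoint B \<longrightarrow> 3 * card B \<le> (k + 3) * card (A n C))"
    by metis
  define size_bound where "size_bound n = (let r = length (xs n) * (length (xs n) + 4) + 1; v = length (xs n) + 1;
      K = (k + 3) * (card (ksets k n) + 1) + 2 in r * (v * K) + r * K + v * K)" for n
  have "\<forall>n. \<exists>P :: affine_form lp. \<forall>C. finite C \<and> A n C \<subseteq> ksets k n \<longrightarrow>
    lp_opt (map_lp (affine_eval C) P) = ereal (real ((k + 3) * card (A n C)) / 3) \<and>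
    lp_size (map_lp (affine_eval C) P) \<le> size_bound n"
    unfolding size_bound_def using circuit_lp[OF xs(1) finite_ksets xs(3)] by blast
  then obtain R :: lp_family where R: "\<And>n C. finite C \<Longrightarrow> A n C \<subseteq> ksets k n \<Longrightarrow>
    lp_opt (map_lp (affine_eval C) (R n)) = ereal (real ((k + 3) * card (A n C)) / 3) \<and>
    lp_size (map_lp (affine_eval C) (R n)) \<le> size_bound n" by metis
  \<comment> \<open>With \<open>s\<close> the size of the packing found, the optimum is exactly
    \<open>(k + 3) * s / 3\<close>. Local optimality puts it above the maximum packing size, giving
    a relaxation; \<open>s \<le> max_packing C\<close> puts it below \<open>k / 3 + 1\<close> times
    that size, giving the gap.\<close>
  have main: "lp_size (lp_of_instance R C) \<le> size_bound (card C) \<and>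
      (\<exists>s. lp_opt (lp_of_instance R C) = ereal (real ((k + 3) * s) / 3) \<and>
        s \<le> max_packing C \<and> 3 * max_packing C \<le> (k + 3) * s)"
    if inst: "set_packing_instance k U C" for U C
  proof -
    let ?C = "normalize_sets C" and ?n = "card C"
    note norm = normalize_sets_props[OF inst]
    have fin: "finite ?C" using norm(1) finite_ksets finite_subset by blast
    note A' = A[OF norm(1,2)]
    have AT: "A ?n ?C \<subseteq> ksets k ?n" using A' norm(1) by blast
    note R' = R[OF fin AT]
    have "card (A ?n ?C) \<le> max_packing C" using card_le_max_packing[OF fin] A' norm(3) by metis
    moreover have "3 * max_packing C \<le> (k + 3) * card (A ?n ?C)"
      using max_packing_attained[OF fin] A' norm(3) by metis
    ultimately show ?thesis using R' unfolding lp_of_instance_def by blast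
  qed
  have "lp_relaxation k R"
    unfolding lp_relaxation_def
  proof (intro allI impI)
    fix U C assume "set_packing_instance k U C"
    then obtain s where s: "lp_opt (lp_of_instance R C) = ereal (real ((k + 3) * s) / 3)"
      "3 * max_packing C \<le> (k + 3) * s" using main by blast
    have "real (3 * max_packing C) \<le> real ((k + 3) * s)" using s(2) by (simp only: of_nat_le_iff)
    then show "ereal (real (max_packing C)) \<le> lp_opt (lp_of_instance R C)" unfolding s(1) by simp
  qed
  moreover have "polynomial_size k R"
  proof -
    have bx: "poly_bounded (\<lambda>n. length (xs n))" unfolding poly_bounded_def using xs(2) by blast
    have bT: "poly_bounded (\<lambda>n. card (ksets k n))"
      by (rule poly_bounded_mono[OF _ card_ksets_le]) (intro poly_bounded_intros)
    have "poly_bounded size_bound"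
      unfolding size_bound_def Let_def by (intro poly_bounded_intros bx bT)
    then show ?thesis unfolding polynomial_size_def poly_bounded_def using main by (meson order_trans)
  qed
  moreover have "integrality_gap k R \<le> ereal (real k / 3 + 1 + \<epsilon>)"
    unfolding integrality_gap_def
  proof (rule SUP_least, clarify)
    fix U C assume inst: "set_packing_instance k U C" and "C \<noteq> {}"
    obtain s where s: "lp_opt (lp_of_instance R C) = ereal (real ((k + 3) * s) / 3)"
      "s \<le> max_packing C" using main[OF inst] by blast
    obtain S where "S \<in> C" using \<open>C \<noteq> {}\<close> by blast
    moreover have "finite C" using inst unfolding set_packing_instance_def by (meson finite_Pow_iff finite_subset)
    \<comment> \<open>A single set is a packing, so the denominator of the ratio is
      positive.\<close>
    ultimately have pos: "max_packing C > 0" using card_le_max_packing[of C "{S}"] by simp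
    have "real (k + 3) * real s \<le> real (k + 3) * real (max_packing C)" using s(2) by (intro mult_left_mono) auto
    then have "real ((k + 3) * s) / 3 / real (max_packing C) \<le> real k / 3 + 1"
      using pos by (simp add: field_simps)
    then show "lp_opt (lp_of_instance R C) / ereal (real (max_packing C)) \<le> ereal (real k / 3 + 1 + \<epsilon>)"
      unfolding s(1) using pos assms(2) by simp
  qed
  ultimately show ?thesis by blast
qed

end
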